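(* Let $P_1,P_2$ be non-commutative Poisson algebras over $K$ of the same class (both of Class 1 or both of Class 2), with degree maps $u_i:P_i\to\mathbb Z_{\ge0}\cup\{-\infty\}$ ($i=1,2$) whose induced filtrations are finite and discrete. Let $z_1\in P_1$, $z_2\in P_2$ and $\Gamma=z_1\otimes1+1\otimes z_2\in P_1\otimes P_2$. For every $\lambda\in K$, $$F(\Gamma,\lambda)=\bigoplus_{\mu\in K}F(z_1,\mu)\otimes F(z_2,\lambda-\mu).$$ In particular, for $\lambda=0$, $$N(\Gamma)=F(\Gamma,0)=\bigoplus_{\lambda\in K}F(z_1,\lambda)\otimes F(z_2,-\lambda).$$ Moreover, with $-Ev(z_2)=\{\lambda\mid-\lambda\in Ev(z_2)\}$, one has $N(\Gamma)=N(z_1)\otimes N(z_2)$ if and only if $Ev(z_1)\cap(-Ev(z_2))=\{0\}$.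
   Context: $K$ is an algebraically closed field of characteristic zero; tensor products are over $K$. A non-commutative Poisson algebra over $K$ is a $K$-vector space $P$ with a bilinear product $\cdot$ making it a unital associative (not necessarily commutative) $K$-algebra and a bilinear bracket $\{\cdot,\cdot\}$ making it a Lie algebra, such that $\{x,yz\}=\{x,y\}z+y\{x,z\}$ for all $x,y,z\in P$. It is of Class 1 if $(P,\cdot)$ is commutative, and of Class 2 if $(P,\cdot)$ is non-commutative and $\{a,b\}=ab-ba$ for all $a,b$. Tensor product: if $P_1,P_2$ are both of Class 1, $P_1\otimes P_2$ carries the bracket $\{a_1\otimes a_2,b_1\otimes b_2\}=\{a_1,b_1\}\otimes a_2b_2+b_1a_1\otimes\{a_2,b_2\}$; if both are of Class 2, the bracket on $P_1\otimes P_2$ is the commutator. This makes $P_1\otimes P_2$ a non-commutative Poisson algebra of the same class. A degree map on $P$ is a map $u:P\to\mathbb Z\cup\{-\infty\}$ such that for all $z,w\in P$: $u(\{z,w\})\le u(zw)=u(z)+u(w)$; $u(z+w)\le\max\{u(z),u(w)\}$; $u(z)=-\infty$ iff $z=0$. Its induced filtration is $P_t=\{a\in P\mid u(a)\le t\}$, $t\in\mathbb Z$; it is finite if every $P_t$ is finite dimensional over $K$ and discrete if $P_t=\{0\}$ for all $t<0$. For an element $z$ of a non-commutative Poisson algebra $P$ and $\lambda\in K$ put $ad_z(w)=\{z,w\}$, $Ev(z)=\{\lambda\in K\mid \exists x\in P\setminus\{0\},\ ad_z(x)=\lambda x\}$, $F(z,\lambda)=\bigcup_{n\ge1}\ker(ad_z-\lambda)^n$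 and $N(z)=F(z,0)=\{x\in P\mid\exists m,\ ad_z^m(x)=0\}$. For $z_i$ these are formed in $P_i$; for $\Gamma$ in $P_1\otimes P_2$. *)

theory Defs
  imports
    "HOL-Algebra.Algebraic_Closure_Type"
    "HOL-Library.Poly_Mapping"
    "HOL-Library.Extended"
begin

section \<open>Non-commutative Poisson algebras\<close>

text \<open>The ground field is a type; algebras are records with an explicit carrier set, so that the
  tensor product below can be built as an honest quotient space.\<close>

record ('k, 'p) nc_poisson = "('k, 'p) module" +
  pbracket :: "'p \<Rightarrow> 'p \<Rightarrow> 'p" (\<open>\<lbrace>_,/ _\<rbrace>\<index>\<close>)

text \<open>The zero algebra is allowed: \<open>\<one> \<noteq> \<zero>\<close> is not required.\<close>

locale nc_poisson_algebra =
    ring P + scalars: module "ring_of_type_algebra :: 'k ring" P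
    for P :: "('k :: field, 'p) nc_poisson" (structure) +
  assumes smult_mult_left: "\<lbrakk>x \<in> carrier P; y \<in> carrier P\<rbrakk> \<Longrightarrow> (c \<odot> x) \<otimes> y = c \<odot> (x \<otimes> y)"
    and smult_mult_right: "\<lbrakk>x \<in> carrier P; y \<in> carrier P\<rbrakk> \<Longrightarrow> x \<otimes> (c \<odot> y) = c \<odot> (x \<otimes> y)"
    and bracket_closed: "\<lbrakk>x \<in> carrier P; y \<in> carrier P\<rbrakk> \<Longrightarrow> \<lbrace>x, y\<rbrace> \<in> carrier P"
    and bracket_add_left: "\<lbrakk>x \<in> carrier P; y \<in> carrier P; z \<in> carrier P\<rbrakk>
          \<Longrightarrow> \<lbrace>x \<oplus> y, z\<rbrace> = \<lbrace>x, z\<rbrace> \<oplus> \<lbrace>y, z\<rbrace>"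
    and bracket_add_right: "\<lbrakk>x \<in> carrier P; y \<in> carrier P; z \<in> carrier P\<rbrakk>
          \<Longrightarrow> \<lbrace>x, y \<oplus> z\<rbrace> = \<lbrace>x, y\<rbrace> \<oplus> \<lbrace>x, z\<rbrace>"
    and bracket_smult_left: "\<lbrakk>x \<in> carrier P; y \<in> carrier P\<rbrakk> \<Longrightarrow> \<lbrace>c \<odot> x, y\<rbrace> = c \<odot> \<lbrace>x, y\<rbrace>"
    and bracket_smult_right: "\<lbrakk>x \<in> carrier P; y \<in> carrier P\<rbrakk> \<Longrightarrow> \<lbrace>x, c \<odot> y\<rbrace> = c \<odot> \<lbrace>x, y\<rbrace>"
    and bracket_self: "x \<in> carrier P \<Longrightarrow> \<lbrace>x, x\<rbrace> = \<zero>"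
    and jacobi: "\<lbrakk>x \<in> carrier P; y \<in> carrier P; z \<in> carrier P\<rbrakk>
          \<Longrightarrow> \<lbrace>x, \<lbrace>y, z\<rbrace>\<rbrace> \<oplus> \<lbrace>y, \<lbrace>z, x\<rbrace>\<rbrace> \<oplus> \<lbrace>z, \<lbrace>x, y\<rbrace>\<rbrace> = \<zero>"
    and leibniz: "\<lbrakk>x \<in> carrier P; y \<in> carrier P; z \<in> carrier P\<rbrakk>
          \<Longrightarrow> \<lbrace>x, y \<otimes> z\<rbrace> = \<lbrace>x, y\<rbrace> \<otimes> z \<oplus> y \<otimes> \<lbrace>x, z\<rbrace>"

definition class_1 :: "('k, 'p) nc_poisson \<Rightarrow> bool" where
  "class_1 P \<longleftrightarrow> (\<forall>a\<in>carrier P. \<forall>b\<in>carrier P. a \<otimes>\<^bsub>P\<^esub> b = b \<otimes>\<^bsub>P\<^esub> a)"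

definition class_2 :: "('k, 'p) nc_poisson \<Rightarrow> bool" where
  "class_2 P \<longleftrightarrow>
     \<not> (\<forall>a\<in>carrier P. \<forall>b\<in>carrier P. a \<otimes>\<^bsub>P\<^esub> b = b \<otimes>\<^bsub>P\<^esub> a) \<and>
     (\<forall>a\<in>carrier P. \<forall>b\<in>carrier P. \<lbrace>a, b\<rbrace>\<^bsub>P\<^esub> = a \<otimes>\<^bsub>P\<^esub> b \<ominus>\<^bsub>P\<^esub> b \<otimes>\<^bsub>P\<^esub> a)"


section \<open>Degree maps and filtrations\<close>

text \<open>The type \<open>int extended\<close> also contains \<open>\<infinity>\<close>, which is excluded explicitly.
  Addition satisfies \<open>-\<infinity> + n = n + -\<infinity> = -\<infinity> + -\<infinity> = -\<infinity>\<close>.\<close>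

definition degree_map :: "('k, 'p) nc_poisson \<Rightarrow> ('p \<Rightarrow> int extended) \<Rightarrow> bool" where
  "degree_map P u \<longleftrightarrow>
     (\<forall>z\<in>carrier P. u z \<noteq> \<infinity>) \<and>
     (\<forall>z\<in>carrier P. \<forall>w\<in>carrier P.
        u \<lbrace>z, w\<rbrace>\<^bsub>P\<^esub> \<le> u (z \<otimes>\<^bsub>P\<^esub> w) \<and> u (z \<otimes>\<^bsub>P\<^esub> w) = u z + u w) \<and>
     (\<forall>z\<in>carrier P. \<forall>w\<in>carrier P. u (z \<oplus>\<^bsub>P\<^esub> w) \<le> max (u z) (u w)) \<and>
     (\<forall>z\<in>carrier P. u z = -\<infinity> \<longleftrightarrow> z = \<zero>\<^bsub>P\<^esub>)"

definition filtration :: "('k, 'p) nc_poisson \<Rightarrow> ('p \<Rightarrow> int extended) \<Rightarrow> int \<Rightarrow> 'p set" where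
  "filtration P u t = {a \<in> carrier P. u a \<le> Fin t}"

definition finite_dimensional_in :: "('k, 'p) nc_poisson \<Rightarrow> 'p set \<Rightarrow> bool" where
  "finite_dimensional_in P W \<longleftrightarrow>
     (\<exists>B. finite B \<and> B \<subseteq> carrier P \<and> W = {\<Oplus>\<^bsub>P\<^esub>b\<in>B. c b \<odot>\<^bsub>P\<^esub> b | c. True})"

definition finite_filtration :: "('k, 'p) nc_poisson \<Rightarrow> ('p \<Rightarrow> int extended) \<Rightarrow> bool" where
  "finite_filtration P u \<longleftrightarrow> (\<forall>t. finite_dimensional_in P (filtration P u t))"

definition discrete_filtration :: "('k, 'p) nc_poisson \<Rightarrow> ('p \<Rightarrow> int extended) \<Rightarrow> bool" where
  "discrete_filtration P u \<longleftrightarrow> (\<forall>t<0. filtration P u t = {\<zero>\<^bsub>P\<^esub>})"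


section \<open>The adjoint action\<close>

definition ad :: "('k, 'p) nc_poisson \<Rightarrow> 'p \<Rightarrow> 'p \<Rightarrow> 'p" where
  "ad P z w = \<lbrace>z, w\<rbrace>\<^bsub>P\<^esub>"

definition Ev :: "('k, 'p) nc_poisson \<Rightarrow> 'p \<Rightarrow> 'k set" where
  "Ev P z = {l. \<exists>x \<in> carrier P - {\<zero>\<^bsub>P\<^esub>}. ad P z x = l \<odot>\<^bsub>P\<^esub> x}"

definition F :: "('k, 'p) nc_poisson \<Rightarrow> 'p \<Rightarrow> 'k \<Rightarrow> 'p set" where
  "F P z l = (\<Union>n\<in>{1..}.
     {x \<in> carrier P. ((\<lambda>w. ad P z w \<ominus>\<^bsub>P\<^esub> l \<odot>\<^bsub>P\<^esub> w) ^^ n) x = \<zero>\<^bsub>P\<^esub>})"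

definition N :: "('k, 'p) nc_poisson \<Rightarrow> 'p \<Rightarrow> 'p set" where
  "N P z = {x \<in> carrier P. \<exists>m. (ad P z ^^ m) x = \<zero>\<^bsub>P\<^esub>}"


section \<open>Tensor products\<close>

text \<open>\<open>P\<^sub>1 \<otimes> P\<^sub>2\<close> is the free vector space on \<open>carrier P\<^sub>1 \<times> carrier P\<^sub>2\<close> modulo the subspace generated by
  the bilinearity relations; its elements are the cosets of that subspace.\<close>

definition free_scale :: "'k :: field \<Rightarrow> ('x \<Rightarrow>\<^sub>0 'k) \<Rightarrow> ('x \<Rightarrow>\<^sub>0 'k)" where
  "free_scale c = Poly_Mapping.map (\<lambda>d. c * d)"

definition free_on :: "'x set \<Rightarrow> ('x \<Rightarrow>\<^sub>0 'k :: field) set" where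
  "free_on A = {f. Poly_Mapping.keys f \<subseteq> A}"

abbreviation gen :: "'x \<Rightarrow> ('x \<Rightarrow>\<^sub>0 'k :: field)" where
  "gen x \<equiv> Poly_Mapping.single x 1"

definition tensor_relations ::
    "('k :: field, 'a) nc_poisson \<Rightarrow> ('k, 'b) nc_poisson \<Rightarrow> ('a \<times> 'b \<Rightarrow>\<^sub>0 'k) set" where
  "tensor_relations P1 P2 = Modules.module.span free_scale
     ({gen (a \<oplus>\<^bsub>P1\<^esub> a', b) - gen (a, b) - gen (a', b) | a a' b.
         a \<in> carrier P1 \<and> a' \<in> carrier P1 \<and> b \<in> carrier P2} \<union>
      {gen (a, b \<oplus>\<^bsub>P2\<^esub> b') - gen (a, b) - gen (a, b') | a b b'.
         a \<in> carrier P1 \<and> b \<in> carrier P2 \<and> b' \<in> carrier P2} \<union>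
      {gen (c \<odot>\<^bsub>P1\<^esub> a, b) - free_scale c (gen (a, b)) | c a b.
         a \<in> carrier P1 \<and> b \<in> carrier P2} \<union>
      {gen (a, c \<odot>\<^bsub>P2\<^esub> b) - free_scale c (gen (a, b)) | c a b.
         a \<in> carrier P1 \<and> b \<in> carrier P2})"

definition tcoset ::
    "('k :: field, 'a) nc_poisson \<Rightarrow> ('k, 'b) nc_poisson \<Rightarrow> ('a \<times> 'b \<Rightarrow>\<^sub>0 'k) \<Rightarrow> ('a \<times> 'b \<Rightarrow>\<^sub>0 'k) set" where
  "tcoset P1 P2 f = (\<lambda>r. f + r) ` tensor_relations P1 P2"

definition pure_tensor ::
    "('k :: field, 'a) nc_poisson \<Rightarrow> ('k, 'b) nc_poisson \<Rightarrow> 'a \<Rightarrow> 'b \<Rightarrow> ('a \<times> 'b \<Rightarrow>\<^sub>0 'k) set" where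
  "pure_tensor P1 P2 a b = tcoset P1 P2 (gen (a, b))"

text \<open>The bilinear extension of a map given on pairs of generators.\<close>

definition bilinear_ext ::
    "('x \<Rightarrow> 'x \<Rightarrow> ('x \<Rightarrow>\<^sub>0 'k :: field)) \<Rightarrow> ('x \<Rightarrow>\<^sub>0 'k) \<Rightarrow> ('x \<Rightarrow>\<^sub>0 'k) \<Rightarrow> ('x \<Rightarrow>\<^sub>0 'k)" where
  "bilinear_ext h f g = (\<Sum>x\<in>Poly_Mapping.keys f. \<Sum>y\<in>Poly_Mapping.keys g.
     free_scale (Poly_Mapping.lookup f x * Poly_Mapping.lookup g y) (h x y))"

text \<open>Operations on cosets are induced from representatives: all cosets in each of the unions below
  coincide, because the operations on the free space respect the relations.\<close>

definition tlift2 ::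
    "('k :: field, 'a) nc_poisson \<Rightarrow> ('k, 'b) nc_poisson
     \<Rightarrow> (('a \<times> 'b \<Rightarrow>\<^sub>0 'k) \<Rightarrow> ('a \<times> 'b \<Rightarrow>\<^sub>0 'k) \<Rightarrow> ('a \<times> 'b \<Rightarrow>\<^sub>0 'k))
     \<Rightarrow> ('a \<times> 'b \<Rightarrow>\<^sub>0 'k) set \<Rightarrow> ('a \<times> 'b \<Rightarrow>\<^sub>0 'k) set \<Rightarrow> ('a \<times> 'b \<Rightarrow>\<^sub>0 'k) set" where
  "tlift2 P1 P2 op A B = (\<Union>f\<in>A. \<Union>g\<in>B. tcoset P1 P2 (op f g))"

definition tensor_algebra ::
    "('k :: field, 'a) nc_poisson \<Rightarrow> ('k, 'b) nc_poisson \<Rightarrow> ('k, ('a \<times> 'b \<Rightarrow>\<^sub>0 'k) set) module" where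
  "tensor_algebra P1 P2 =
     \<lparr> carrier = tcoset P1 P2 ` free_on (carrier P1 \<times> carrier P2),
       monoid.mult = tlift2 P1 P2
         (bilinear_ext (\<lambda>(a1, a2) (b1, b2). gen (a1 \<otimes>\<^bsub>P1\<^esub> b1, a2 \<otimes>\<^bsub>P2\<^esub> b2))),
       monoid.one = pure_tensor P1 P2 \<one>\<^bsub>P1\<^esub> \<one>\<^bsub>P2\<^esub>,
       ring.zero = tcoset P1 P2 0,
       ring.add = tlift2 P1 P2 (+),
       module.smult = (\<lambda>c A. \<Union>f\<in>A. tcoset P1 P2 (free_scale c f)) \<rparr>"

definition class_1_bracket ::
    "('k :: field, 'a) nc_poisson \<Rightarrow> ('k, 'b) nc_poisson
     \<Rightarrow> ('a \<times> 'b \<Rightarrow>\<^sub>0 'k) set \<Rightarrow> ('a \<times> 'b \<Rightarrow>\<^sub>0 'k) set \<Rightarrow> ('a \<times> 'b \<Rightarrow>\<^sub>0 'k) set" where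
  "class_1_bracket P1 P2 = tlift2 P1 P2
     (bilinear_ext (\<lambda>(a1, a2) (b1, b2).
        gen (\<lbrace>a1, b1\<rbrace>\<^bsub>P1\<^esub>, a2 \<otimes>\<^bsub>P2\<^esub> b2) + gen (b1 \<otimes>\<^bsub>P1\<^esub> a1, \<lbrace>a2, b2\<rbrace>\<^bsub>P2\<^esub>)))"

definition commutator_bracket ::
    "('k :: field, 'a) nc_poisson \<Rightarrow> ('k, 'b) nc_poisson
     \<Rightarrow> ('a \<times> 'b \<Rightarrow>\<^sub>0 'k) set \<Rightarrow> ('a \<times> 'b \<Rightarrow>\<^sub>0 'k) set \<Rightarrow> ('a \<times> 'b \<Rightarrow>\<^sub>0 'k) set" where
  "commutator_bracket P1 P2 A B =
     A \<otimes>\<^bsub>tensor_algebra P1 P2\<^esub> B \<ominus>\<^bsub>tensor_algebra P1 P2\<^esub> B \<otimes>\<^bsub>tensor_algebra P1 P2\<^esub> A"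

text \<open>Only meaningful when both factors are of Class 1 or both are of Class 2.\<close>

definition poisson_tensor ::
    "('k :: field, 'a) nc_poisson \<Rightarrow> ('k, 'b) nc_poisson
     \<Rightarrow> ('k, ('a \<times> 'b \<Rightarrow>\<^sub>0 'k) set) nc_poisson" where
  "poisson_tensor P1 P2 = module.extend (tensor_algebra P1 P2) (nc_poisson.fields
     (if class_1 P1 \<and> class_1 P2 then class_1_bracket P1 P2 else commutator_bracket P1 P2))"

text \<open>For subspaces \<open>V\<close>, \<open>W\<close> of the factors, \<open>V \<otimes> W\<close> is identified with its image in
  \<open>P\<^sub>1 \<otimes> P\<^sub>2\<close> (over a field the canonical map is injective).\<close>

definition tensor_subspace ::
    "('k :: field, 'a) nc_poisson \<Rightarrow> ('k, 'b) nc_poisson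
     \<Rightarrow> 'a set \<Rightarrow> 'b set \<Rightarrow> ('a \<times> 'b \<Rightarrow>\<^sub>0 'k) set set" where
  "tensor_subspace P1 P2 V W =
     {\<Oplus>\<^bsub>poisson_tensor P1 P2\<^esub>i\<in>{..<n}. pure_tensor P1 P2 (v i) (w i) | (n :: nat) v w.
        (\<forall>i<n. v i \<in> V \<and> w i \<in> W)}"

text \<open>\<open>W\<close> is the internal direct sum of the family of subspaces \<open>S i\<close>, \<open>i \<in> I\<close>.\<close>

definition is_direct_sum :: "('k, 'p) nc_poisson \<Rightarrow> 'p set \<Rightarrow> 'i set \<Rightarrow> ('i \<Rightarrow> 'p set) \<Rightarrow> bool" where
  "is_direct_sum P W I S \<longleftrightarrow>
     W = {\<Oplus>\<^bsub>P\<^esub>i\<in>M. x i | M x. finite M \<and> M \<subseteq> I \<and> (\<forall>i\<in>M. x i \<in> S i)} \<and>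
     (\<forall>M x. finite M \<and> M \<subseteq> I \<and> (\<forall>i\<in>M. x i \<in> S i) \<and> (\<Oplus>\<^bsub>P\<^esub>i\<in>M. x i) = \<zero>\<^bsub>P\<^esub>
        \<longrightarrow> (\<forall>i\<in>M. x i = \<zero>\<^bsub>P\<^esub>))"

end

(* With D1 = ad z1 and D2 = ad z2, ad Gamma is the operator D1 (x) 1 + 1 (x) D2 on P1 (x) P2.

   Let A be the sum of all generalised eigenspaces of D1. Over an algebraically closed field, P1/A
   has no nonzero finite-dimensional D1-invariant subspace. If (ad Gamma - l) y lies in A (x) P2 and
   y = sum_b v_b (x) b with b from a basis of P2, comparing coefficients shows that D1 maps the span
   of the v_b into itself modulo A, so all v_b lie in A. By induction, every generalised eigenvector
   y of ad Gamma lies in A (x) P2, that is, y = sum_m y_m with y_m in F(z1, m) (x) P2. These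
   are generalised eigenspaces of D1 (x) 1, which commutes with ad Gamma; hence each y_m is a
   generalised eigenvector of ad Gamma for l, therefore of 1 (x) D2 for l - m, and so lies in
   F(z1, m) (x) F(z2, l - m). Independence of the generalised eigenspaces of D1 (x) 1 also makes the
   sum direct. *)

theory Submission
  imports Defs
begin

section \<open>Free vector spaces\<close>

text \<open>The quotient P1/A is never formed: a statement modulo a subspace A becomes one about all
  functionals vanishing on A (\<open>separation\<close>), and identities of vectors are checked on
  functionals (\<open>eqI_dual\<close>). On the tensor product the functionals \<phi> (x) \<psi> do
  the same and read off coefficients. P1 may be infinite-dimensional, so the generalised eigenspaces
  of ad z1 need not exhaust it; this is why membership in A (x) P2 must precede any decomposition.
  An element of P1 (x) P2 has finitely many coefficients v, which yields a nonzero polynomial p with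
  p(D1) v in A; p splits into linear factors, and each D1 - m is injective modulo A. For the last
  equivalence: the summand of index m in N(Gamma) is nonzero exactly when m lies in Ev(z1) and -m in
  Ev(z2), because a nonzero generalised eigenspace contains an eigenvector and a tensor of nonzero
  vectors is nonzero. In nonzero algebras the index 0 always occurs, since ad z kills the
  unit.\<close>

lemma lookup_free_scale [simp]:
  "Poly_Mapping.lookup (free_scale c f) x = c * Poly_Mapping.lookup f x"
  by (simp add: free_scale_def Poly_Mapping.map.rep_eq when_def)

interpretation free: vector_space free_scale
  by unfold_locales (auto intro!: poly_mapping_eqI simp: lookup_add algebra_simps)

lemma gen_eq_iff: "(gen x :: 'x \<Rightarrow>\<^sub>0 'k :: field) = gen y \<longleftrightarrow> x = y"
proof
  assume "(gen x :: 'x \<Rightarrow>\<^sub>0 'k) = gen y"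
  hence "Poly_Mapping.keys (gen x :: 'x \<Rightarrow>\<^sub>0 'k) = Poly_Mapping.keys (gen y :: 'x \<Rightarrow>\<^sub>0 'k)" by simp
  thus "x = y" by simp
qed simp

lemma keys_free_scale: "Poly_Mapping.keys (free_scale c f) \<subseteq> Poly_Mapping.keys f"
  by (auto simp: in_keys_iff)

lemma subspace_free_on: "free.subspace (free_on A :: ('x \<Rightarrow>\<^sub>0 'k :: field) set)"
proof (rule free.subspaceI)
  show "f + g \<in> free_on A" if "f \<in> free_on A" "g \<in> free_on A" for f g :: "'x \<Rightarrow>\<^sub>0 'k"
    using that Poly_Mapping.keys_add[of f g] by (auto simp: free_on_def)
  show "free_scale c f \<in> free_on A" if "f \<in> free_on A" for c and f :: "'x \<Rightarrow>\<^sub>0 'k"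
    using that keys_free_scale[of c f] by (auto simp: free_on_def)
qed (simp add: free_on_def)

lemma gen_in_free_on: "x \<in> A \<Longrightarrow> gen x \<in> free_on A"
  by (simp add: free_on_def)

lemma free_on_expand:
  assumes "finite S" "Poly_Mapping.keys f \<subseteq> S"
  shows "f = (\<Sum>x\<in>S. free_scale (Poly_Mapping.lookup f x) (gen x))"
  using assms
  by (intro poly_mapping_eqI)
    (auto simp: lookup_sum lookup_single when_def if_distrib sum.delta in_keys_iff cong: if_cong)

lemma free_on_eq_span: "free_on A = free.span (gen ` A)"
proof (rule subset_antisym)
  show "free.span (gen ` A) \<subseteq> free_on A"
    by (rule free.span_minimal[OF _ subspace_free_on]) (auto simp: gen_in_free_on)
  show "free_on A \<subseteq> free.span (gen ` A)"
  proof
    fix f assume "f \<in> free_on A"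
    hence "(\<Sum>x\<in>Poly_Mapping.keys f. free_scale (Poly_Mapping.lookup f x) (gen x)) \<in> free.span (gen ` A)"
      by (intro free.span_sum free.span_scale free.span_base) (auto simp: free_on_def)
    thus "f \<in> free.span (gen ` A)" using free_on_expand[of "Poly_Mapping.keys f" f] by simp
  qed
qed

section \<open>Linear and bilinear extension from generators\<close>

definition lin_ext :: "('k \<Rightarrow> 'v \<Rightarrow> 'v) \<Rightarrow> ('x \<Rightarrow> 'v) \<Rightarrow> ('x \<Rightarrow>\<^sub>0 'k :: field) \<Rightarrow> 'v :: ab_group_add" where
  "lin_ext s h f = (\<Sum>x\<in>Poly_Mapping.keys f. s (Poly_Mapping.lookup f x) (h x))"

lemma lin_ext_superset:
  assumes "vector_space s" "finite S" "Poly_Mapping.keys f \<subseteq> S"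
  shows "lin_ext s h f = (\<Sum>x\<in>S. s (Poly_Mapping.lookup f x) (h x))"
proof -
  interpret vector_space s by fact
  show ?thesis unfolding lin_ext_def
    by (rule sum.mono_neutral_left) (use assms in \<open>auto simp: in_keys_iff\<close>)
qed

lemma lin_ext_gen [simp]: "vector_space s \<Longrightarrow> lin_ext s h (gen x) = h x"
  unfolding lin_ext_def by (simp add: vector_space.vector_space_assms(4))

lemma linear_lin_ext:
  fixes s :: "'k :: field \<Rightarrow> 'v \<Rightarrow> 'v :: ab_group_add"
  assumes "vector_space s"
  shows "Vector_Spaces.linear free_scale s (lin_ext s h)"
proof -
  interpret s: vector_space s by fact
  show ?thesis
  proof (intro Vector_Spaces.linear_iff[THEN iffD2] conjI allI free.vector_space_axioms s.vector_space_axioms)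
    fix f g :: "'a \<Rightarrow>\<^sub>0 'k" and c :: 'k
    have "finite (Poly_Mapping.keys f \<union> Poly_Mapping.keys g)" by simp
    note * = lin_ext_superset[OF assms this]
    show "lin_ext s h (f + g) = lin_ext s h f + lin_ext s h g"
      using Poly_Mapping.keys_add[of f g]
      by (simp add: * lookup_add s.scale_left_distrib sum.distrib)
    have "lin_ext s h (free_scale c f) =
        (\<Sum>x\<in>Poly_Mapping.keys f. s (Poly_Mapping.lookup (free_scale c f) x) (h x))"
      by (rule lin_ext_superset[OF assms finite_keys keys_free_scale])
    thus "lin_ext s h (free_scale c f) = s c (lin_ext s h f)"
      by (simp add: lin_ext_def s.scale_sum_right)
  qed
qed

lemma vector_space_field: "vector_space ((*) :: 'k :: field \<Rightarrow> 'k \<Rightarrow> 'k)"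
  by unfold_locales (auto simp: algebra_simps)

lemma
  fixes s :: "'k :: field \<Rightarrow> 'v \<Rightarrow> 'v :: ab_group_add"
  assumes s: "vector_space s"
  shows lin_ext_add: "lin_ext s h (f + g) = lin_ext s h f + lin_ext s h g"
    and lin_ext_diff: "lin_ext s h (f - g) = lin_ext s h f - lin_ext s h g"
    and lin_ext_scale: "lin_ext s h (free_scale c f) = s c (lin_ext s h f)"
    and lin_ext_zero: "lin_ext s h 0 = 0"
proof -
  interpret l: Vector_Spaces.linear free_scale s "lin_ext s h" by (rule linear_lin_ext[OF s])
  show "lin_ext s h (f + g) = lin_ext s h f + lin_ext s h g" by (rule l.add)
  show "lin_ext s h (f - g) = lin_ext s h f - lin_ext s h g" by (rule l.diff)
  show "lin_ext s h (free_scale c f) = s c (lin_ext s h f)" by (rule l.scale)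
  show "lin_ext s h 0 = 0" by (rule l.zero)
qed

lemmas lin_ext_simps = lin_ext_add lin_ext_diff lin_ext_scale lin_ext_zero lin_ext_gen

text \<open>With \<open>f\<close> outermost, linearity in \<open>f\<close> is an instance of that of
  \<open>lin_ext\<close>; \<open>bilinear_ext_swap\<close> puts \<open>g\<close> outermost and does
  the same for \<open>g\<close>.\<close>

lemma bilinear_ext_lin_ext:
  "bilinear_ext h f g = lin_ext free_scale (\<lambda>x. lin_ext free_scale (h x) g) f"
  by (simp add: bilinear_ext_def lin_ext_def free.scale_sum_right)

lemma bilinear_ext_swap:
  "bilinear_ext h f g = lin_ext free_scale (\<lambda>y. lin_ext free_scale (\<lambda>x. h x y) f) g"
  unfolding bilinear_ext_def lin_ext_def free.scale_sum_right free.scale_scale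
  by (subst sum.swap) (simp add: mult.commute)

lemma bilinear_ext_left:
  "bilinear_ext h (f + f') g = bilinear_ext h f g + bilinear_ext h f' g"
  "bilinear_ext h (f - f') g = bilinear_ext h f g - bilinear_ext h f' g"
  "bilinear_ext h (free_scale c f) g = free_scale c (bilinear_ext h f g)"
  "bilinear_ext h (gen x) (gen y) = h x y"
  by (simp_all add: bilinear_ext_lin_ext lin_ext_simps[OF free.vector_space_axioms])

lemma bilinear_ext_right:
  "bilinear_ext h f (g + g') = bilinear_ext h f g + bilinear_ext h f g'"
  "bilinear_ext h f (g - g') = bilinear_ext h f g - bilinear_ext h f g'"
  "bilinear_ext h f (free_scale c g) = free_scale c (bilinear_ext h f g)"
  by (simp_all add: bilinear_ext_swap lin_ext_simps[OF free.vector_space_axioms])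

lemmas bilinear_ext_simps = bilinear_ext_left bilinear_ext_right

lemma lin_ext_subspace:
  assumes "vector_space s" "module.subspace s Y" "f \<in> free_on A" "\<And>x. x \<in> A \<Longrightarrow> h x \<in> Y"
  shows "lin_ext s h f \<in> Y"
proof -
  interpret vector_space s by fact
  show ?thesis unfolding lin_ext_def
    using assms(3,4) by (intro subspace_sum[OF assms(2)] subspace_scale[OF assms(2)]) (auto simp: free_on_def)
qed

section \<open>Linear functionals and relative bases\<close>

lemma type_algebra_simps [simp]:
  "carrier ring_of_type_algebra = UNIV"
  "\<one>\<^bsub>ring_of_type_algebra\<^esub> = 1" "\<zero>\<^bsub>ring_of_type_algebra\<^esub> = 0"
  "x \<otimes>\<^bsub>ring_of_type_algebra\<^esub> y = x * y" "x \<oplus>\<^bsub>ring_of_type_algebra\<^esub> y = x + y"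
  by (auto simp: ring_of_type_algebra_def)

text \<open>Nothing is required outside the carrier, so one functional on the space is represented
  by many functions; only values at carrier elements are compared.\<close>

definition dual :: "('k :: field, 'p, 'm) module_scheme \<Rightarrow> ('p \<Rightarrow> 'k) set" where
  "dual M = {\<phi>. (\<forall>x\<in>carrier M. \<forall>y\<in>carrier M. \<phi> (x \<oplus>\<^bsub>M\<^esub> y) = \<phi> x + \<phi> y) \<and>
     (\<forall>c. \<forall>x\<in>carrier M. \<phi> (c \<odot>\<^bsub>M\<^esub> x) = c * \<phi> x)}"

definition endo :: "('k :: field, 'p, 'm) module_scheme \<Rightarrow> ('p \<Rightarrow> 'p) \<Rightarrow> bool" where
  "endo M D \<longleftrightarrow> (\<forall>x\<in>carrier M. D x \<in> carrier M) \<and>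
     (\<forall>x\<in>carrier M. \<forall>y\<in>carrier M. D (x \<oplus>\<^bsub>M\<^esub> y) = D x \<oplus>\<^bsub>M\<^esub> D y) \<and>
     (\<forall>c. \<forall>x\<in>carrier M. D (c \<odot>\<^bsub>M\<^esub> x) = c \<odot>\<^bsub>M\<^esub> D x)"

definition lsub :: "('k :: field, 'p, 'm) module_scheme \<Rightarrow> 'p set \<Rightarrow> bool" where
  "lsub M A \<longleftrightarrow> A \<subseteq> carrier M \<and> \<zero>\<^bsub>M\<^esub> \<in> A \<and> (\<forall>x\<in>A. \<forall>y\<in>A. x \<oplus>\<^bsub>M\<^esub> y \<in> A) \<and>
     (\<forall>c. \<forall>x\<in>A. c \<odot>\<^bsub>M\<^esub> x \<in> A)"

text \<open>The scalars fill a type while the vectors form a carrier set. The open record scheme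
  lets the same results serve the factors, the tensor algebra and the Poisson tensor
  product.\<close>

locale kvspace = module "ring_of_type_algebra :: 'k :: field ring" M
  for M :: "('k :: field, 'p, 'm) module_scheme" (structure)
begin

lemmas smult_simps =
  smult_l_distr[simplified] smult_r_distr[simplified] smult_assoc1[simplified]

lemma smult_closed' [simp, intro]: "x \<in> carrier M \<Longrightarrow> c \<odot> x \<in> carrier M"
  using smult_closed by simp

lemma smult_one' [simp]: "x \<in> carrier M \<Longrightarrow> 1 \<odot> x = x"
  using smult_one by simp

lemma smult_0' [simp]: "x \<in> carrier M \<Longrightarrow> 0 \<odot> x = \<zero>"
  using smult_l_null by simp

lemma smult_zero' [simp]: "c \<odot> \<zero> = \<zero>"
  using smult_r_null by simp

lemma minus_eq_smult: "x \<in> carrier M \<Longrightarrow> y \<in> carrier M \<Longrightarrow> x \<ominus> y = x \<oplus> (-1) \<odot> y"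
proof -
  assume x: "x \<in> carrier M" "y \<in> carrier M"
  have "(-1) \<odot> y \<oplus> y = (-1 + 1) \<odot> y"
    using x smult_simps(1)[of y "-1" 1] by simp
  hence "\<ominus> y = (-1) \<odot> y" using x by (intro M.minus_equality) auto
  thus ?thesis by (simp add: a_minus_def)
qed

lemma dual_zero: "\<phi> \<in> dual M \<Longrightarrow> \<phi> \<zero> = 0"
proof -
  assume "\<phi> \<in> dual M"
  hence "\<phi> (0 \<odot> \<zero>) = 0 * \<phi> \<zero>" unfolding dual_def using M.zero_closed by blast
  thus ?thesis by simp
qed

lemma dual_add: "\<phi> \<in> dual M \<Longrightarrow> x \<in> carrier M \<Longrightarrow> y \<in> carrier M \<Longrightarrow> \<phi> (x \<oplus> y) = \<phi> x + \<phi> y"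
  and dual_smult: "\<phi> \<in> dual M \<Longrightarrow> x \<in> carrier M \<Longrightarrow> \<phi> (c \<odot> x) = c * \<phi> x"
  by (auto simp: dual_def)

lemma dual_minus: "\<phi> \<in> dual M \<Longrightarrow> x \<in> carrier M \<Longrightarrow> y \<in> carrier M \<Longrightarrow> \<phi> (x \<ominus> y) = \<phi> x - \<phi> y"
  by (simp add: minus_eq_smult dual_add dual_smult)

lemma dual_finsum:
  assumes "\<phi> \<in> dual M" "\<And>i. i \<in> S \<Longrightarrow> f i \<in> carrier M"
  shows "\<phi> (\<Oplus>i\<in>S. f i) = (\<Sum>i\<in>S. \<phi> (f i))"
  using assms(2)
  by (induction S rule: infinite_finite_induct)
    (auto simp: dual_zero[OF assms(1)] dual_add[OF assms(1)])

lemmas dual_simps = dual_zero dual_add dual_smult dual_minus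

lemma endo_simps:
  assumes "endo M D"
  shows endo_closed: "x \<in> carrier M \<Longrightarrow> D x \<in> carrier M"
    and endo_add: "x \<in> carrier M \<Longrightarrow> y \<in> carrier M \<Longrightarrow> D (x \<oplus> y) = D x \<oplus> D y"
    and endo_smult: "x \<in> carrier M \<Longrightarrow> D (c \<odot> x) = c \<odot> D x"
    and endo_zero: "D \<zero> = \<zero>"
    and endo_minus: "x \<in> carrier M \<Longrightarrow> y \<in> carrier M \<Longrightarrow> D (x \<ominus> y) = D x \<ominus> D y"
proof -
  show "x \<in> carrier M \<Longrightarrow> D x \<in> carrier M" for x using assms by (auto simp: endo_def)
  show "D \<zero> = \<zero>"
  proof -
    have "D (0 \<odot> \<zero>) = 0 \<odot> D \<zero>" "D \<zero> \<in> carrier M"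
      using assms M.zero_closed unfolding endo_def by blast+
    thus ?thesis by simp
  qed
qed (use assms in \<open>auto simp: endo_def minus_eq_smult\<close>)

lemma endo_finsum:
  assumes "endo M D" "\<And>i. i \<in> S \<Longrightarrow> f i \<in> carrier M"
  shows "D (\<Oplus>i\<in>S. f i) = (\<Oplus>i\<in>S. D (f i))"
  using assms(2)
  by (induction S rule: infinite_finite_induct)
    (auto simp: endo_zero[OF assms(1)] endo_add[OF assms(1)] endo_closed[OF assms(1)])

lemma dual_endo: "\<phi> \<in> dual M \<Longrightarrow> endo M D \<Longrightarrow> \<phi> \<circ> D \<in> dual M"
  by (auto simp: dual_def endo_def)

lemma lsub_simps:
  assumes "lsub M A"
  shows lsub_carrier: "x \<in> A \<Longrightarrow> x \<in> carrier M"
    and lsub_zero: "\<zero> \<in> A"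
    and lsub_add: "x \<in> A \<Longrightarrow> y \<in> A \<Longrightarrow> x \<oplus> y \<in> A"
    and lsub_smult: "x \<in> A \<Longrightarrow> c \<odot> x \<in> A"
    and lsub_minus: "x \<in> A \<Longrightarrow> y \<in> A \<Longrightarrow> x \<ominus> y \<in> A"
proof -
  show 1: "x \<in> A \<Longrightarrow> x \<in> carrier M" for x using assms by (auto simp: lsub_def)
  show "x \<in> A \<Longrightarrow> y \<in> A \<Longrightarrow> x \<ominus> y \<in> A"
    using assms 1 by (auto simp: lsub_def minus_eq_smult)
qed (use assms in \<open>auto simp: lsub_def\<close>)

lemma lsub_finsum:
  assumes "lsub M A" "\<And>i. i \<in> S \<Longrightarrow> f i \<in> A"
  shows "(\<Oplus>i\<in>S. f i) \<in> A"
  using assms(2)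
proof (induction S rule: infinite_finite_induct)
  case (insert i S)
  hence "f \<in> S \<rightarrow> carrier M" "f i \<in> carrier M" using lsub_carrier[OF assms(1)] by auto
  thus ?case using insert lsub_add[OF assms(1)] by simp
qed (auto simp: lsub_zero[OF assms(1)])

lemma lsub_carrier_self: "lsub M (carrier M)"
  by (auto simp: lsub_def)

lemma lsub_0: "lsub M {\<zero>}"
  by (auto simp: lsub_def)

text \<open>The canonical surjection from the free space on the carrier. It pulls subspaces of the
  carrier back to subspaces of a vector space that fills a type.\<close>

definition evaluate :: "('p \<Rightarrow>\<^sub>0 'k) \<Rightarrow> 'p" where
  "evaluate f = (\<Oplus>a\<in>Poly_Mapping.keys f. Poly_Mapping.lookup f a \<odot> a)"

lemma evaluate_superset:
  assumes "finite S" "Poly_Mapping.keys f \<subseteq> S" "S \<subseteq> carrier M"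
  shows "evaluate f = (\<Oplus>a\<in>S. Poly_Mapping.lookup f a \<odot> a)"
  unfolding evaluate_def
  by (rule M.add.finprod_mono_neutral_cong_left) (use assms in \<open>auto simp: in_keys_iff\<close>)

lemma evaluate_closed: "f \<in> free_on (carrier M) \<Longrightarrow> evaluate f \<in> carrier M"
  unfolding evaluate_def by (rule M.finsum_closed) (auto simp: free_on_def)

lemma evaluate_add:
  assumes "f \<in> free_on (carrier M)" "g \<in> free_on (carrier M)"
  shows "evaluate (f + g) = evaluate f \<oplus> evaluate g"
proof -
  let ?S = "Poly_Mapping.keys f \<union> Poly_Mapping.keys g"
  have S: "finite ?S" "?S \<subseteq> carrier M" using assms by (auto simp: free_on_def)
  have "evaluate (f + g) = (\<Oplus>a\<in>?S. Poly_Mapping.lookup (f + g) a \<odot> a)"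
    by (rule evaluate_superset[OF S(1) Poly_Mapping.keys_add S(2)])
  also have "\<dots> = (\<Oplus>a\<in>?S. Poly_Mapping.lookup f a \<odot> a \<oplus> Poly_Mapping.lookup g a \<odot> a)"
    by (rule M.finsum_cong') (use S in \<open>auto simp: lookup_add smult_simps\<close>)
  also have "\<dots> = evaluate f \<oplus> evaluate g"
    using S by (subst M.finsum_addf) (auto simp: evaluate_superset[OF S(1) _ S(2)])
  finally show ?thesis .
qed

lemma evaluate_scale:
  assumes "f \<in> free_on (carrier M)"
  shows "evaluate (free_scale c f) = c \<odot> evaluate f"
proof -
  let ?S = "Poly_Mapping.keys f"
  have S: "finite ?S" "?S \<subseteq> carrier M" using assms by (auto simp: free_on_def)
  have "endo M (\<lambda>x. c \<odot> x)" by (auto simp: endo_def smult_simps(2) mult.commute simp flip: smult_simps(3))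
  hence "c \<odot> evaluate f = (\<Oplus>a\<in>?S. c \<odot> (Poly_Mapping.lookup f a \<odot> a))"
    unfolding evaluate_def by (rule endo_finsum) (use S in auto)
  also have "\<dots> = (\<Oplus>a\<in>?S. Poly_Mapping.lookup (free_scale c f) a \<odot> a)"
    by (rule M.finsum_cong') (use S in \<open>auto simp: smult_simps\<close>)
  also have "\<dots> = evaluate (free_scale c f)"
    by (rule evaluate_superset[OF S(1) keys_free_scale S(2), symmetric])
  finally show ?thesis by simp
qed

lemma evaluate_gen: "a \<in> carrier M \<Longrightarrow> evaluate (gen a) = a"
  by (simp add: evaluate_def)

lemma evaluate_minus:
  assumes "f \<in> free_on (carrier M)" "g \<in> free_on (carrier M)"
  shows "evaluate (f - g) = evaluate f \<ominus> evaluate g"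
proof -
  have "evaluate (f - g) = evaluate (f + free_scale (-1) g)" by simp
  also have "\<dots> = evaluate f \<oplus> (-1) \<odot> evaluate g"
    using assms free.subspace_scale[OF subspace_free_on assms(2), of "-1"]
    by (simp only: evaluate_add evaluate_scale)
  finally show ?thesis using assms by (simp add: minus_eq_smult evaluate_closed)
qed

lemma evaluate_sum:
  assumes "\<And>i. i \<in> S \<Longrightarrow> f i \<in> free_on (carrier M)"
  shows "evaluate (\<Sum>i\<in>S. f i) = (\<Oplus>i\<in>S. evaluate (f i))"
  using assms
proof (induction S rule: infinite_finite_induct)
  case (insert i S)
  hence "(\<Sum>i\<in>S. f i) \<in> free_on (carrier M)" by (intro free.subspace_sum[OF subspace_free_on]) auto
  thus ?case using insert by (simp add: evaluate_add evaluate_closed)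
qed (auto simp: evaluate_def)

lemma subspace_evaluate:
  assumes "lsub M A"
  shows "free.subspace {f \<in> free_on (carrier M). evaluate f \<in> A}"
proof (rule free.subspaceI)
  show "0 \<in> {f \<in> free_on (carrier M). evaluate f \<in> A}"
    using lsub_zero[OF assms] by (simp add: evaluate_def free.subspace_0[OF subspace_free_on])
qed (auto simp: evaluate_add evaluate_scale lsub_add[OF assms] lsub_smult[OF assms]
    free.subspace_add[OF subspace_free_on] free.subspace_scale[OF subspace_free_on])

text \<open>A basis of \<open>U\<close> modulo \<open>A\<close>, with dual functionals defined on the whole space.\<close>

definition rel_basis :: "'p set \<Rightarrow> 'p set \<Rightarrow> 'p set \<Rightarrow> ('p \<Rightarrow> 'p \<Rightarrow> 'k) \<Rightarrow> bool" where
  "rel_basis A U B \<phi> \<longleftrightarrow> B \<subseteq> U \<and>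
     (\<forall>b\<in>B. \<phi> b \<in> dual M \<and> (\<forall>a\<in>A. \<phi> b a = 0) \<and> (\<forall>b'\<in>B. \<phi> b b' = (if b = b' then 1 else 0))) \<and>
     (\<forall>u\<in>U. finite {b\<in>B. \<phi> b u \<noteq> 0} \<and> u \<ominus> (\<Oplus>b\<in>{b\<in>B. \<phi> b u \<noteq> 0}. \<phi> b u \<odot> b) \<in> A)"

text \<open>Everything is lifted to the free vector space on the carrier, where the library provides bases.\<close>

lemma rel_basis_exists:
  assumes A: "lsub M A" and U: "lsub M U" and "A \<subseteq> U"
  obtains B \<phi> where "rel_basis A U B \<phi>"
proof -
  \<comment> \<open>The preimage of \<open>A\<close> contains the kernel of \<open>evaluate\<close>,
    hence every defect of linearity of \<open>gen\<close>.\<close>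
  define RA where "RA = {f \<in> free_on (carrier M). evaluate f \<in> A}"
  have sRA: "free.subspace RA" unfolding RA_def by (rule subspace_evaluate[OF A])
  obtain C where C: "C \<subseteq> RA" "free.independent C" "RA \<subseteq> free.span C"
    by (rule free.basis_exists[of RA])
  have spC: "free.span C = RA" using C(3) free.span_minimal[OF C(1) sRA] by auto
  \<comment> \<open>The vectors added to \<open>C\<close> are generators \<open>gen u\<close>, so
    the new part of the basis is indexed by elements of \<open>U\<close>.\<close>
  obtain C' where C': "C \<subseteq> C'" "C' \<subseteq> C \<union> gen ` U" "free.independent C'" "C \<union> gen ` U \<subseteq> free.span C'"
    by (rule free.maximal_independent_subset_extend[of C "C \<union> gen ` U"]) (use C in auto)
  \<comment> \<open>Extending once more, to the whole free space, provides coordinates for every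
    \<open>w\<close> in the carrier and not only for those in \<open>U\<close>.\<close>
  define E where "E = free.extend_basis C'"
  have E: "C' \<subseteq> E" "free.independent E" "free.span E = UNIV"
    using free.extend_basis_superset[OF C'(3)] free.independent_extend_basis[OF C'(3)]
      free.span_extend_basis[OF C'(3)] by (auto simp: E_def)
  define B where "B = {b \<in> U. gen b \<in> C' - C}"
  define rep where "rep = free.representation E"
  \<comment> \<open>The coordinate of \<open>gen w\<close> at \<open>gen b\<close>. It is linear in
    \<open>w\<close> although \<open>gen\<close> is not:
    \<open>gen (x \<oplus> y) - (gen x + gen y)\<close> lies in \<open>RA\<close>, where this
    coordinate vanishes by \<open>rep_RA\<close>.\<close>
  define \<phi> where "\<phi> b w = rep (gen w) (gen b)" for b w
  have rep_add: "rep (f + g) x = rep f x + rep g x" for f g x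
    using free.representation_add[OF E(2)] E(3) by (simp add: rep_def)
  have rep_diff: "rep (f - g) x = rep f x - rep g x" for f g x
    using free.representation_diff[OF E(2)] E(3) by (simp add: rep_def)
  have rep_scale: "rep (free_scale c f) x = c * rep f x" for c f x
    using free.representation_scale[OF E(2)] E(3) by (simp add: rep_def)
  have rep_RA: "rep r (gen b) = 0" if "r \<in> RA" "b \<in> B" for r b
  proof -
    have "rep r = free.representation C r" unfolding rep_def
      using that(1) C'(1) E(1) spC by (intro free.representation_extend[OF E(2)]) auto
    thus ?thesis using free.representation_ne_zero[of C r "gen b"] that(2) by (auto simp: B_def)
  qed
  have BU: "B \<subseteq> U" by (auto simp: B_def)
  have UM: "U \<subseteq> carrier M" using lsub_carrier[OF U] by auto
  have g: "gen x \<in> free_on (carrier M)" if "x \<in> carrier M" for x :: 'p using that by (rule gen_in_free_on)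
  note fo = free.subspace_add[OF subspace_free_on] free.subspace_diff[OF subspace_free_on] free.subspace_scale[OF subspace_free_on] g
  have inRA: "f \<in> RA" if "f \<in> free_on (carrier M)" "evaluate f = \<zero>" for f
    using that lsub_zero[OF A] by (simp add: RA_def)
  have dl: "\<phi> b \<in> dual M" if b: "b \<in> B" for b
  proof -
    have "\<phi> b (x \<oplus> y) = \<phi> b x + \<phi> b y" if "x \<in> carrier M" "y \<in> carrier M" for x y
    proof -
      have "gen (x \<oplus> y) - (gen x + gen y) \<in> RA"
        using that by (intro inRA fo) (auto simp: evaluate_minus evaluate_add evaluate_gen fo M.r_neg a_minus_def)
      from rep_RA[OF this b] show ?thesis by (simp add: rep_diff rep_add \<phi>_def)
    qed
    moreover have "\<phi> b (c \<odot> x) = c * \<phi> b x" if "x \<in> carrier M" for c x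
    proof -
      have "gen (c \<odot> x) - free_scale c (gen x) \<in> RA"
        using that by (intro inRA fo) (auto simp: evaluate_minus evaluate_gen evaluate_scale fo M.r_neg a_minus_def)
      from rep_RA[OF this b] show ?thesis by (simp add: rep_diff rep_scale \<phi>_def)
    qed
    ultimately show ?thesis by (auto simp: dual_def)
  qed
  have exp: "finite {b\<in>B. \<phi> b u \<noteq> 0} \<and> u \<ominus> (\<Oplus>b\<in>{b\<in>B. \<phi> b u \<noteq> 0}. \<phi> b u \<odot> b) \<in> A" if u: "u \<in> U" for u
  proof -
    define S where "S = {b\<in>B. \<phi> b u \<noteq> 0}"
    have uC: "gen u \<in> free.span C'" using C'(4) u by auto
    have ru: "rep (gen u) = free.representation C' (gen u)" unfolding rep_def
      using uC E by (intro free.representation_extend) auto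
    let ?R = "{c. rep (gen u) c \<noteq> 0}"
    have fin: "finite ?R" unfolding ru by (rule free.finite_representation)
    have sum: "(\<Sum>c\<in>?R. free_scale (rep (gen u) c) c) = gen u"
      unfolding ru by (rule free.sum_nonzero_representation_eq[OF C'(3) uC])
    have RC': "?R \<subseteq> C'" using free.representation_ne_zero ru by fastforce
    \<comment> \<open>The part of the support in \<open>C\<close> evaluates into \<open>A\<close>;
      the rest consists of the generators indexed by \<open>S\<close> and gives the sum in the
      claim.\<close>
    have Rd: "?R = (?R \<inter> C) \<union> gen ` S"
      using RC' C'(2) by (auto simp: S_def B_def \<phi>_def)
    have inj: "inj_on gen S" by (rule inj_onI) (simp add: gen_eq_iff)
    have "gen ` S \<subseteq> ?R" by (auto simp: S_def \<phi>_def)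
    hence finS: "finite S" using finite_imageD[OF finite_subset[OF _ fin] inj] by simp
    have "gen u = (\<Sum>c\<in>?R \<inter> C. free_scale (rep (gen u) c) c) + (\<Sum>c\<in>gen ` S. free_scale (rep (gen u) c) c)"
    proof -
      have "(\<Sum>c\<in>?R. free_scale (rep (gen u) c) c) = (\<Sum>c\<in>(?R \<inter> C) \<union> gen ` S. free_scale (rep (gen u) c) c)"
        using Rd by simp
      also have "\<dots> = (\<Sum>c\<in>?R \<inter> C. free_scale (rep (gen u) c) c) + (\<Sum>c\<in>gen ` S. free_scale (rep (gen u) c) c)"
        by (rule sum.union_disjoint) (use fin finS in \<open>auto simp: S_def B_def\<close>)
      finally show ?thesis using sum by simp
    qed
    also have "(\<Sum>c\<in>gen ` S. free_scale (rep (gen u) c) c) = (\<Sum>b\<in>S. free_scale (\<phi> b u) (gen b))"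
      by (subst sum.reindex[OF inj]) (simp add: \<phi>_def)
    finally have *: "gen u - (\<Sum>b\<in>S. free_scale (\<phi> b u) (gen b)) = (\<Sum>c\<in>?R \<inter> C. free_scale (rep (gen u) c) c)"
      by (simp only: diff_eq_eq)
    have "(\<Sum>c\<in>?R \<inter> C. free_scale (rep (gen u) c) c) \<in> RA" using C(1) by (intro free.subspace_sum[OF sRA] free.subspace_scale[OF sRA]) auto
    hence "evaluate (gen u - (\<Sum>b\<in>S. free_scale (\<phi> b u) (gen b))) \<in> A" by (simp add: * RA_def)
    moreover have SM: "S \<subseteq> carrier M" using BU UM by (auto simp: S_def)
    hence "evaluate (gen u - (\<Sum>b\<in>S. free_scale (\<phi> b u) (gen b))) = u \<ominus> (\<Oplus>b\<in>S. evaluate (free_scale (\<phi> b u) (gen b)))"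
      using u UM by (subst evaluate_minus) (auto simp: evaluate_gen evaluate_sum fo subsetD intro!: free.subspace_sum[OF subspace_free_on] fo)
    moreover have "(\<Oplus>b\<in>S. evaluate (free_scale (\<phi> b u) (gen b))) = (\<Oplus>b\<in>S. \<phi> b u \<odot> b)"
      by (rule M.finsum_cong') (use SM in \<open>auto simp: evaluate_scale evaluate_gen g\<close>)
    ultimately show ?thesis using finS by (simp add: S_def)
  qed
  have "\<phi> b a = 0" if "b \<in> B" "a \<in> A" for b a
    using that \<open>A \<subseteq> U\<close> UM unfolding \<phi>_def by (intro rep_RA) (auto simp: RA_def evaluate_gen g subsetD)
  moreover have "\<phi> b b' = (if b = b' then 1 else 0)" if "b \<in> B" "b' \<in> B" for b b'
  proof -
    have "rep (gen b') = (\<lambda>v. if v = gen b' then 1 else 0)"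
      unfolding rep_def using that E(1) by (intro free.representation_basis[OF E(2)]) (auto simp: B_def)
    thus ?thesis by (auto simp: \<phi>_def gen_eq_iff)
  qed
  ultimately show ?thesis
    using BU dl exp by (intro that[of B \<phi>]) (simp add: rel_basis_def)
qed

text \<open>Relative to a basis of the whole space modulo \<open>A\<close>, all coefficients of
  \<open>x\<close> vanish, and the expansion leaves \<open>x\<close> itself in \<open>A\<close>.
  This stands in for computing in the quotient by \<open>A\<close>.\<close>

lemma separation:
  assumes A: "lsub M A" and x: "x \<in> carrier M"
    and "\<And>\<phi>. \<phi> \<in> dual M \<Longrightarrow> (\<And>a. a \<in> A \<Longrightarrow> \<phi> a = 0) \<Longrightarrow> \<phi> x = 0"
  shows "x \<in> A"
proof -
  have "A \<subseteq> carrier M" using lsub_carrier[OF A] by auto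
  then obtain B \<phi> where B: "rel_basis A (carrier M) B \<phi>"
    using rel_basis_exists[OF A lsub_carrier_self] by blast
  hence *: "{b\<in>B. \<phi> b x \<noteq> 0} = {}" using assms(3) unfolding rel_basis_def by blast
  have "x \<ominus> (\<Oplus>b\<in>{b\<in>B. \<phi> b x \<noteq> 0}. \<phi> b x \<odot> b) \<in> A"
    using B x unfolding rel_basis_def by blast
  thus ?thesis using x unfolding * by (simp add: minus_eq_smult)
qed

lemma minus_eq_zeroD:
  assumes "x \<in> carrier M" "y \<in> carrier M" "x \<ominus> y = \<zero>"
  shows "x = y"
proof -
  have "\<ominus> (\<ominus> y) = x" using assms by (intro M.minus_equality) (auto simp: a_minus_def)
  thus ?thesis using assms by (simp add: M.minus_minus)
qed

text \<open>Separation for the zero subspace. Applying an arbitrary functional turns a vector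
  identity into an identity in the field, where \<open>algebra_simps\<close> decides it.\<close>

lemma eqI_dual:
  assumes x: "x \<in> carrier M" "y \<in> carrier M" and eq: "\<And>\<phi>. \<phi> \<in> dual M \<Longrightarrow> \<phi> x = \<phi> y"
  shows "x = y"
proof -
  have "x \<ominus> y \<in> {\<zero>}"
    using x eq by (intro separation[OF lsub_0]) (auto simp: dual_minus)
  thus ?thesis using minus_eq_zeroD[OF x] by simp
qed

end

section \<open>Generalised eigenspaces\<close>

text \<open>Closed under sums only, so that inductions have no scalar case. It is the linear span as
  soon as \<open>Z\<close> is closed under scalars (\<open>addclo_smult_closed\<close>), as a union
  of subspaces or a set of pure tensors over two subspaces is.\<close>

inductive_set addclo :: "('p, 'm) ring_scheme \<Rightarrow> 'p set \<Rightarrow> 'p set" for M Z where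
  zero: "\<zero>\<^bsub>M\<^esub> \<in> addclo M Z"
| base: "x \<in> Z \<Longrightarrow> x \<in> addclo M Z"
| add: "x \<in> addclo M Z \<Longrightarrow> y \<in> addclo M Z \<Longrightarrow> x \<oplus>\<^bsub>M\<^esub> y \<in> addclo M Z"

lemma addclo_mono: "x \<in> addclo M Z \<Longrightarrow> (\<And>x. x \<in> Z \<Longrightarrow> x \<in> addclo M Y) \<Longrightarrow> x \<in> addclo M Y"
  by (induction rule: addclo.induct) (auto intro: addclo.intros)

definition shift :: "('k :: field, 'p, 'm) module_scheme \<Rightarrow> ('p \<Rightarrow> 'p) \<Rightarrow> 'k \<Rightarrow> 'p \<Rightarrow> 'p" where
  "shift M D l w = D w \<ominus>\<^bsub>M\<^esub> l \<odot>\<^bsub>M\<^esub> w"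

definition geig :: "('k :: field, 'p, 'm) module_scheme \<Rightarrow> ('p \<Rightarrow> 'p) \<Rightarrow> 'k \<Rightarrow> 'p set" where
  "geig M D l = {x \<in> carrier M. \<exists>n. (shift M D l ^^ n) x = \<zero>\<^bsub>M\<^esub>}"

context kvspace
begin

lemma addclo_carrier: "x \<in> addclo M Z \<Longrightarrow> Z \<subseteq> carrier M \<Longrightarrow> x \<in> carrier M"
  by (induction rule: addclo.induct) auto

lemma addclo_lsub: "x \<in> addclo M Z \<Longrightarrow> lsub M A \<Longrightarrow> Z \<subseteq> A \<Longrightarrow> x \<in> A"
  by (induction rule: addclo.induct) (auto simp: lsub_zero lsub_add)

lemma addclo_smult_closed:
  assumes "Z \<subseteq> carrier M" "\<And>c x. x \<in> Z \<Longrightarrow> c \<odot> x \<in> Z"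
  shows "lsub M (addclo M Z)"
proof -
  have "c \<odot> x \<in> addclo M Z" if "x \<in> addclo M Z" for c x
    using that
  proof (induction rule: addclo.induct)
    case (add x y)
    thus ?case using addclo_carrier[OF _ assms(1)]
      by (simp add: smult_simps addclo.add)
  qed (auto intro: addclo.intros assms(2))
  thus ?thesis
    using addclo_carrier[OF _ assms(1)] by (auto simp: lsub_def intro: addclo.intros)
qed

lemma endo_addclo:
  assumes "endo M D" "Z \<subseteq> carrier M" "\<And>x. x \<in> Z \<Longrightarrow> D x \<in> Y" "x \<in> addclo M Z"
  shows "D x \<in> addclo M Y"
  using assms(4)
  by (induction rule: addclo.induct)
    (auto simp: endo_zero[OF assms(1)] endo_add[OF assms(1)] addclo_carrier[OF _ assms(2)]
      intro: addclo.intros assms(3))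

lemma finsum_superset:
  assumes "finite K" "J \<subseteq> K" "\<And>i. i \<in> K - J \<Longrightarrow> x i = \<zero>" "\<And>i. i \<in> J \<Longrightarrow> x i \<in> carrier M"
  shows "(\<Oplus>i\<in>J. x i) = (\<Oplus>i\<in>K. x i)"
proof (rule M.add.finprod_mono_neutral_cong_left)
  show "x \<in> K \<rightarrow> carrier M" using assms(3,4) M.zero_closed by (metis DiffI Pi_I)
qed (use assms in auto)

lemma addclo_Union_finsum:
  assumes "y \<in> addclo M (\<Union>i\<in>I. S i)" "\<And>i. i \<in> I \<Longrightarrow> S i \<subseteq> carrier M"
    "\<And>i. i \<in> I \<Longrightarrow> \<zero> \<in> S i"
    "\<And>i x y. i \<in> I \<Longrightarrow> x \<in> S i \<Longrightarrow> y \<in> S i \<Longrightarrow> x \<oplus> y \<in> S i"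
  obtains J x where "finite J" "J \<subseteq> I" "\<forall>i\<in>I. x i \<in> S i" "y = (\<Oplus>i\<in>J. x i)"
proof -
  \<comment> \<open>The extra clause that \<open>x i\<close> vanishes off \<open>J\<close> allows
    two sums to be rewritten over the common index set \<open>J \<union> J'\<close> and added
    termwise.\<close>
  have "\<exists>J x. finite J \<and> J \<subseteq> I \<and> (\<forall>i\<in>I. x i \<in> S i) \<and> (\<forall>i. i \<notin> J \<longrightarrow> x i = \<zero>) \<and> y = (\<Oplus>i\<in>J. x i)"
    using assms(1)
  proof (induction rule: addclo.induct)
    case zero
    show ?case using assms(3) by (intro exI[of _ "{}"] exI[of _ "\<lambda>_. \<zero>"]) auto
  next
    case (base y)
    then obtain i where i: "i \<in> I" "y \<in> S i" by auto
    hence "y \<in> carrier M" using assms(2) by auto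
    thus ?case using i assms(3)
      by (intro exI[of _ "{i}"] exI[of _ "\<lambda>j. if j = i then y else \<zero>"]) auto
  next
    case (add y y')
    then obtain J x J' x' where
      J: "finite J" "J \<subseteq> I" "\<forall>i\<in>I. x i \<in> S i" "\<forall>i. i \<notin> J \<longrightarrow> x i = \<zero>" "y = (\<Oplus>i\<in>J. x i)" and
      J': "finite J'" "J' \<subseteq> I" "\<forall>i\<in>I. x' i \<in> S i" "\<forall>i. i \<notin> J' \<longrightarrow> x' i = \<zero>" "y' = (\<Oplus>i\<in>J'. x' i)"
      by blast
    have C: "x i \<in> carrier M" "x' i \<in> carrier M" if "i \<in> J \<union> J'" for i
      using J(2,3) J'(2,3) assms(2) that by blast+
    have "y = (\<Oplus>i\<in>J \<union> J'. x i)" unfolding J(5)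
      by (rule finsum_superset) (use J J' C in auto)
    moreover have "y' = (\<Oplus>i\<in>J \<union> J'. x' i)" unfolding J'(5)
      by (rule finsum_superset) (use J J' C in auto)
    ultimately have "y \<oplus> y' = (\<Oplus>i\<in>J \<union> J'. x i \<oplus> x' i)"
      using C by (subst M.finsum_addf) auto
    thus ?case using J J' assms(4)
      by (intro exI[of _ "J \<union> J'"] exI[of _ "\<lambda>i. x i \<oplus> x' i"]) auto
  qed
  thus ?thesis using that by blast
qed

lemma endo_shift:
  assumes "endo M D"
  shows "endo M (shift M D l)"
proof -
  note D = endo_closed[OF assms] endo_add[OF assms] endo_smult[OF assms]
  show ?thesis unfolding endo_def shift_def
  proof (intro conjI ballI allI)
    fix x y assume xy: "x \<in> carrier M" "y \<in> carrier M"
    show "D (x \<oplus> y) \<ominus> l \<odot> (x \<oplus> y) = D x \<ominus> l \<odot> x \<oplus> (D y \<ominus> l \<odot> y)"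
      using xy by (intro eqI_dual) (auto simp: dual_simps D algebra_simps)
  next
    fix c x assume "x \<in> carrier M"
    thus "D (c \<odot> x) \<ominus> l \<odot> (c \<odot> x) = c \<odot> (D x \<ominus> l \<odot> x)"
      by (intro eqI_dual) (auto simp: dual_simps D algebra_simps)
  qed (use D in auto)
qed

lemma endo_funpow: "endo M D \<Longrightarrow> endo M (D ^^ n)"
  by (induction n) (auto simp: endo_def)

lemma funpow_zero_mono:
  assumes "endo M D" "(D ^^ n) x = \<zero>" "n \<le> m"
  shows "(D ^^ m) x = \<zero>"
proof -
  have "(D ^^ m) x = (D ^^ (m - n)) ((D ^^ n) x)"
    using assms(3) by (simp flip: funpow_add comp_apply[of "D ^^ _" "D ^^ _"])
  thus ?thesis using endo_zero[OF endo_funpow[OF assms(1)]] assms(2) by simp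
qed

lemma lsub_geig:
  assumes "endo M D"
  shows "lsub M (geig M D l)"
proof -
  let ?S = "shift M D l"
  note S = endo_shift[OF assms, of l]
  note Sn = endo_funpow[OF S]
  have "x \<oplus> y \<in> geig M D l" if xy: "x \<in> geig M D l" "y \<in> geig M D l" for x y
  proof -
    obtain n m where "(?S ^^ n) x = \<zero>" "(?S ^^ m) y = \<zero>" using xy by (auto simp: geig_def)
    hence "(?S ^^ (n + m)) x = \<zero>" "(?S ^^ (n + m)) y = \<zero>"
      using funpow_zero_mono[OF S] by auto
    hence "(?S ^^ (n + m)) (x \<oplus> y) = \<zero>"
      using xy by (simp add: endo_add[OF Sn] geig_def)
    thus ?thesis using xy unfolding geig_def by blast
  qed
  moreover have "c \<odot> x \<in> geig M D l" if x: "x \<in> geig M D l" for c x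
  proof -
    obtain n where "(?S ^^ n) x = \<zero>" using x by (auto simp: geig_def)
    hence "(?S ^^ n) (c \<odot> x) = \<zero>" using x by (simp add: endo_smult[OF Sn] geig_def)
    thus ?thesis using x unfolding geig_def by blast
  qed
  moreover have "\<zero> \<in> geig M D l"
    using endo_zero[OF Sn] by (auto simp: geig_def)
  ultimately show ?thesis by (auto simp: lsub_def geig_def)
qed

lemma geig_carrier: "x \<in> geig M D l \<Longrightarrow> x \<in> carrier M"
  by (simp add: geig_def)

lemma geig_shiftD:
  assumes "x \<in> carrier M" "shift M D l x \<in> geig M D l"
  shows "x \<in> geig M D l"
proof -
  obtain n where "(shift M D l ^^ n) (shift M D l x) = \<zero>" using assms by (auto simp: geig_def)
  hence "(shift M D l ^^ Suc n) x = \<zero>" by (simp add: funpow_swap1)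
  thus ?thesis using assms(1) unfolding geig_def by blast
qed

text \<open>Induction on the power of D - l that kills \<open>x\<close>: the shifted vector is
  killed by a smaller power.\<close>

lemma geig_induct [consumes 2, case_names zero shift]:
  assumes D: "endo M D" and "x \<in> geig M D l" and "P \<zero>"
    and step: "\<And>x. x \<in> geig M D l \<Longrightarrow> shift M D l x \<in> geig M D l \<Longrightarrow> P (shift M D l x) \<Longrightarrow> P x"
  shows "P x"
proof -
  have "x \<in> carrier M \<Longrightarrow> (shift M D l ^^ n) x = \<zero> \<Longrightarrow> P x" for n
  proof (induction n arbitrary: x)
    case 0 thus ?case using assms(3) by simp
  next
    case (Suc n)
    have 1: "(shift M D l ^^ n) (shift M D l x) = \<zero>" using Suc.prems by (simp add: funpow_swap1)
    have 2: "shift M D l x \<in> carrier M" by (rule endo_closed[OF endo_shift[OF D] Suc.prems(1)])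
    have "shift M D l x \<in> geig M D l" using 1 2 unfolding geig_def by blast
    thus ?case using Suc.IH[OF 2 1] geig_shiftD[OF Suc.prems(1)] step by blast
  qed
  thus ?thesis using assms(2) by (auto simp: geig_def)
qed

lemma shift_commute:
  assumes "endo M D" "endo M G" "\<And>x. x \<in> carrier M \<Longrightarrow> G (D x) = D (G x)" "x \<in> carrier M"
  shows "G (shift M D l x) = shift M D l (G x)"
  using assms unfolding shift_def
  by (simp add: endo_minus[OF assms(2)] endo_smult[OF assms(2)] endo_closed[OF assms(1)])

lemma geig_commute:
  assumes "endo M D" "endo M G" "\<And>x. x \<in> carrier M \<Longrightarrow> G (D x) = D (G x)" "x \<in> geig M D l"
  shows "G x \<in> geig M D l"
  using assms(1,4)
proof (induction rule: geig_induct)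
  case zero
  show ?case using lsub_zero[OF lsub_geig[OF assms(1)]] by (simp add: endo_zero[OF assms(2)])
next
  case (shift x)
  note x = geig_carrier[OF shift(1)]
  have "G (shift M D l x) = shift M D l (G x)"
    by (rule shift_commute[OF assms(1,2) _ x]) (rule assms(3))
  thus ?case using shift(3) geig_shiftD[OF endo_closed[OF assms(2) x]] by simp
qed

lemma geig_shift: "endo M D \<Longrightarrow> x \<in> geig M D l \<Longrightarrow> shift M D m x \<in> geig M D l"
  by (rule geig_commute) (auto simp: endo_shift shift_commute[symmetric])

lemma shift_shift:
  assumes "endo M D" "x \<in> carrier M"
  shows "shift M D m x = shift M D l x \<oplus> (l - m) \<odot> x"
  using assms endo_closed[OF assms]
  by (intro eqI_dual) (auto simp: shift_def dual_simps algebra_simps)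

text \<open>The two shifts commute, so D - m kills (D - l) x as well; by induction (D - l) x = 0,
  and (D - m) x = 0 then reads (l - m) x = 0.\<close>

lemma geig_shift_inj:
  assumes D: "endo M D" "x \<in> geig M D l" and "shift M D m x = \<zero>" "m \<noteq> l"
  shows "x = \<zero>"
  using D assms(3)
proof (induction rule: geig_induct)
  case (shift x)
  have x: "x \<in> carrier M" using shift by (simp add: geig_def)
  have "shift M D m (shift M D l x) = shift M D l (shift M D m x)"
    by (rule shift_commute[OF D(1) endo_shift[OF D(1)] _ x, symmetric])
      (use shift_commute[OF D(1) D(1)] in auto)
  hence "shift M D l x = \<zero>"
    using shift endo_zero[OF endo_shift[OF D(1)]] by simp
  hence "(l - m) \<odot> x = \<zero>"
    using shift_shift[OF D(1) x, of m l] shift.prems x by simp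
  hence "(1 / (l - m)) \<odot> ((l - m) \<odot> x) = \<zero>" by simp
  thus ?case using x assms(4) by (simp flip: smult_simps(3))
qed simp

lemma geig_shift_surj:
  assumes D: "endo M D" "x \<in> geig M D l" and "m \<noteq> l"
  obtains t where "t \<in> geig M D l" "shift M D m t = x"
proof -
  note G = lsub_geig[OF D(1), of l]
  have "\<exists>t\<in>geig M D l. shift M D m t = x"
    using D
  proof (induction rule: geig_induct)
    case zero
    show ?case using lsub_zero[OF G] endo_zero[OF endo_shift[OF D(1)]] by auto
  next
    case (shift x)
    then obtain t where t: "t \<in> geig M D l" "shift M D m t = shift M D l x" by auto
    have C: "x \<in> carrier M" "t \<in> carrier M" "D x \<in> carrier M" "D t \<in> carrier M"
      using shift t endo_closed[OF D(1)] by (auto simp: geig_def)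
    have *: "\<phi> (D t) = \<phi> (D x) - l * \<phi> x + m * \<phi> t" if "\<phi> \<in> dual M" for \<phi>
      using arg_cong[OF t(2), of \<phi>] that C by (simp add: shift_def dual_simps algebra_simps)
    \<comment> \<open>By the choice of \<open>t\<close>, (D - m)(x - t) = (D - l) x + (l - m) x - (D
      - m) t = (l - m) x, which explains the scalar.\<close>
    let ?u = "(1 / (l - m)) \<odot> (x \<ominus> t)"
    have "shift M D m (c \<odot> (x \<ominus> t)) = (c * (l - m)) \<odot> x" for c
      using C by (intro eqI_dual)
        (auto simp: shift_def dual_simps endo_simps[OF D(1)] * algebra_simps)
    hence "shift M D m ?u = x" using C assms(3) by simp
    moreover have "?u \<in> geig M D l"
      using shift t by (intro lsub_smult[OF G] lsub_minus[OF G])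
    ultimately show ?case by blast
  qed
  thus ?thesis using that by blast
qed

text \<open>By induction (D - l) x = 0, while \<open>x\<close> lies in the generalised eigenspace
  for \<open>m\<close>, on which D - l is injective.\<close>

lemma geig_disjoint:
  assumes D: "endo M D" "x \<in> geig M D l" and "x \<in> geig M D m" "m \<noteq> l"
  shows "x = \<zero>"
  using D assms(3)
proof (induction rule: geig_induct)
  case (shift x)
  hence "shift M D l x = \<zero>" using geig_shift[OF D(1)] by blast
  thus ?case using geig_shift_inj[OF D(1) shift(4)] assms(4) by blast
qed simp

lemma geig_independent:
  assumes D: "endo M D" and "finite J" "\<And>i. i \<in> J \<Longrightarrow> x i \<in> geig M D i"
    and "(\<Oplus>i\<in>J. x i) = \<zero>" "i \<in> J"
  shows "x i = \<zero>"
  using assms(2-)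
proof (induction J arbitrary: x i rule: finite_induct)
  case (insert j J)
  have C: "\<And>i. i \<in> insert j J \<Longrightarrow> x i \<in> carrier M" using insert.prems by (auto simp: geig_def)
  obtain n where n: "(shift M D j ^^ n) (x j) = \<zero>"
    using insert.prems(1)[of j] by (auto simp: geig_def)
  \<comment> \<open>A power of D - j that kills \<open>x j\<close> keeps the other terms in their
    eigenspaces. By the induction hypothesis it kills each of them, which puts them into the
    eigenspace for \<open>j\<close> too.\<close>
  let ?S = "shift M D j ^^ n"
  note S = endo_funpow[OF endo_shift[OF D, of j], of n]
  have gS: "y \<in> geig M D l \<Longrightarrow> (shift M D j ^^ k) y \<in> geig M D l" for y l k
    by (induction k) (auto simp: geig_shift[OF D])
  have "\<zero> = ?S (x j \<oplus> (\<Oplus>i\<in>J. x i))"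
    using insert.prems(2) insert.hyps C endo_zero[OF S] by simp
  also have "\<dots> = (\<Oplus>i\<in>J. ?S (x i))"
    using C n by (simp add: endo_add[OF S] endo_finsum[OF S] endo_closed[OF S])
  finally have "(\<Oplus>i\<in>J. ?S (x i)) = \<zero>" by simp
  hence "?S (x i) = \<zero>" if "i \<in> J" for i
    using insert.IH[of "\<lambda>i. ?S (x i)" i] gS insert.prems(1) that by blast
  hence "x i \<in> geig M D j" if "i \<in> J" for i using that C unfolding geig_def by blast
  hence J0: "x i = \<zero>" if "i \<in> J" for i
    using that insert.prems(1)[of i] insert.hyps geig_disjoint[OF D, of "x i" i j] by auto
  hence "(\<Oplus>i\<in>J. x i) = \<zero>" by (intro M.add.finprod_one_eqI)
  hence "x j = \<zero>" using insert.prems(2) insert.hyps C by simp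
  thus ?case using J0 insert.prems(3) by blast
qed simp

text \<open>Over an algebraically closed field these are the vectors killed by some nonzero
  polynomial in \<open>D\<close>, the algebraic vectors of \<open>D\<close>.\<close>

definition alg :: "('p \<Rightarrow> 'p) \<Rightarrow> 'p set" where
  "alg D = addclo M (\<Union>l. geig M D l)"

lemma lsub_alg:
  assumes "endo M D"
  shows "lsub M (alg D)"
  unfolding alg_def
  by (rule addclo_smult_closed) (auto intro: geig_carrier lsub_smult[OF lsub_geig[OF assms]])

lemma geig_alg: "x \<in> geig M D l \<Longrightarrow> x \<in> alg D"
  unfolding alg_def by (rule addclo.base) auto

lemma endo_alg:
  assumes "endo M D" "x \<in> alg D"
  shows "D x \<in> alg D"
  using assms unfolding alg_def
  by (intro endo_addclo[OF assms(1)]) (auto intro: geig_carrier geig_commute)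

text \<open>The quotient by the span of the generalised eigenspaces has no eigenvectors.\<close>

lemma alg_shiftD:
  assumes D: "endo M D" and x: "x \<in> carrier M" and "shift M D m x \<in> alg D"
  shows "x \<in> alg D"
proof -
  note A = lsub_alg[OF D]
  note S = endo_shift[OF D, of m]
  note G = lsub_geig[OF D, of m]
  \<comment> \<open>On the generalised eigenspaces for eigenvalues other than \<open>m\<close> the
    operator D - m is onto; the component for \<open>m\<close> itself goes into
    \<open>r\<close>.\<close>
  have "\<exists>t\<in>alg D. \<exists>r\<in>geig M D m. a = shift M D m t \<oplus> r" if "a \<in> alg D" for a
    using that unfolding alg_def
  proof (induction rule: addclo.induct)
    case zero
    show ?case
      using addclo.zero lsub_zero[OF G] endo_zero[OF S] M.r_zero[OF M.zero_closed] by metis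
  next
    case (base a)
    then obtain l where a: "a \<in> geig M D l" by auto
    hence aC: "a \<in> carrier M" by (rule geig_carrier)
    show ?case
    proof (cases "l = m")
      case True
      thus ?thesis using a aC by (intro bexI[of _ "\<zero>"] bexI[of _ a]) (auto simp: endo_zero[OF S] addclo.zero)
    next
      case False
      then obtain t where "t \<in> geig M D l" "shift M D m t = a"
        using geig_shift_surj[OF D a, of m] by blast
      thus ?thesis using aC lsub_zero[OF G]
        by (intro bexI[of _ t] bexI[of _ "\<zero>"]) (auto intro: addclo.base)
    qed
  next
    case (add a b)
    then obtain t r t' r' where *: "t \<in> alg D" "t' \<in> alg D" "r \<in> geig M D m" "r' \<in> geig M D m"
      "a = shift M D m t \<oplus> r" "b = shift M D m t' \<oplus> r'" unfolding alg_def by blast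
    have "t \<in> carrier M" "t' \<in> carrier M" "r \<in> carrier M" "r' \<in> carrier M"
      using * lsub_carrier[OF A] geig_carrier by auto
    hence "a \<oplus> b = shift M D m (t \<oplus> t') \<oplus> (r \<oplus> r')"
      unfolding * by (simp add: endo_add[OF S] endo_closed[OF S] M.a_ac)
    thus ?case using * lsub_add[OF A] lsub_add[OF G] unfolding alg_def by blast
  qed
  then obtain t r where tr: "t \<in> alg D" "r \<in> geig M D m" "shift M D m x = shift M D m t \<oplus> r"
    using assms(3) by blast
  have C: "t \<in> carrier M" "r \<in> carrier M" using tr lsub_carrier[OF A] geig_carrier by auto
  \<comment> \<open>Subtracting \<open>t\<close> leaves a vector that D - m sends into the
    generalised eigenspace for \<open>m\<close>, so it lies there itself.\<close>
  have "shift M D m (x \<ominus> t) = r"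
    using x C by (simp add: endo_minus[OF S] tr(3))
      (intro eqI_dual, auto simp: dual_simps endo_closed[OF S])
  hence "x \<ominus> t \<in> geig M D m" using tr x C geig_shiftD[of "x \<ominus> t"] by simp
  hence "(x \<ominus> t) \<oplus> t \<in> alg D" using tr(1) by (rule lsub_add[OF A geig_alg])
  moreover have "(x \<ominus> t) \<oplus> t = x" using x C by (intro eqI_dual) (auto simp: dual_simps)
  ultimately show ?thesis by simp
qed

section \<open>Polynomials in an endomorphism\<close>

definition pact :: "('p \<Rightarrow> 'p) \<Rightarrow> 'k poly \<Rightarrow> 'p \<Rightarrow> 'p" where
  "pact D p v = (\<Oplus>k\<in>{..Polynomial.degree p}. Polynomial.coeff p k \<odot> (D ^^ k) v)"

lemma pact_closed: "endo M D \<Longrightarrow> v \<in> carrier M \<Longrightarrow> pact D p v \<in> carrier M"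
  unfolding pact_def by (auto intro!: M.finsum_closed simp: endo_closed[OF endo_funpow])

text \<open>The summation bound may exceed the degree, so that polynomials of different degrees can
  be compared over one range.\<close>

lemma dual_pact:
  assumes "endo M D" "v \<in> carrier M" "\<phi> \<in> dual M" "Polynomial.degree p \<le> n"
  shows "\<phi> (pact D p v) = (\<Sum>k\<le>n. Polynomial.coeff p k * \<phi> ((D ^^ k) v))"
proof -
  have "\<phi> (pact D p v) = (\<Sum>k\<le>Polynomial.degree p. Polynomial.coeff p k * \<phi> ((D ^^ k) v))"
    unfolding pact_def using assms
    by (simp add: dual_finsum dual_simps endo_closed[OF endo_funpow])
  also have "\<dots> = (\<Sum>k\<le>n. Polynomial.coeff p k * \<phi> ((D ^^ k) v))"
    by (rule sum.mono_neutral_left) (use assms(4) Polynomial.coeff_eq_0 in \<open>auto simp: not_le\<close>)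
  finally show ?thesis .
qed

lemma pact_linear_factor:
  assumes D: "endo M D" and v: "v \<in> carrier M"
  shows "pact D ([:-m, 1:] * q) v = shift M D m (pact D q v)"
proof (rule eqI_dual)
  show "pact D ([:- m, 1:] * q) v \<in> carrier M" by (rule pact_closed[OF D v])
  show "shift M D m (pact D q v) \<in> carrier M" using endo_closed[OF endo_shift[OF D]] pact_closed[OF D v] by auto
next
  fix \<phi> assume \<phi>: "\<phi> \<in> dual M"
  let ?n = "Polynomial.degree q" and ?f = "\<lambda>k. \<phi> ((D ^^ k) v)"
  have "Polynomial.degree ([:-m, 1:] * q) \<le> Suc ?n"
    using Polynomial.degree_mult_le[of "[:-m, 1:]" q] by simp
  hence "\<phi> (pact D ([:-m, 1:] * q) v) = (\<Sum>k\<le>Suc ?n. Polynomial.coeff ([:-m, 1:] * q) k * ?f k)"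
    by (rule dual_pact[OF D v \<phi>])
  also have "\<dots> = (\<Sum>k\<le>Suc ?n. Polynomial.coeff (pCons 0 q) k * ?f k) - m * (\<Sum>k\<le>Suc ?n. Polynomial.coeff q k * ?f k)"
    by (simp add: algebra_simps sum.distrib sum_subtractf sum_distrib_left del: sum.atMost_Suc)
  also have "(\<Sum>k\<le>Suc ?n. Polynomial.coeff (pCons 0 q) k * ?f k) = (\<Sum>k\<le>?n. Polynomial.coeff q k * ?f (Suc k))"
    by (subst sum.atMost_Suc_shift) simp
  \<comment> \<open>The index shift caused by the factor X is absorbed by replacing \<phi> with
    \<open>\<phi> \<circ> D\<close>.\<close>
  also have "\<dots> = (\<phi> \<circ> D) (pact D q v)"
    by (subst dual_pact[OF D v dual_endo[OF \<phi> D] order_refl]) simp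
  also have "(\<Sum>k\<le>Suc ?n. Polynomial.coeff q k * ?f k) = \<phi> (pact D q v)"
    by (rule dual_pact[OF D v \<phi>, symmetric]) simp
  finally show "\<phi> (pact D ([:- m, 1:] * q) v) = \<phi> (shift M D m (pact D q v))"
    using pact_closed[OF D v] endo_closed[OF D] \<phi> by (simp add: shift_def dual_simps)
qed

end

text \<open>The rows \<open>e 0\<close>, ..., \<open>e (card S)\<close> are one more than the
  dimension of the coordinate space over \<open>S\<close>, hence dependent.\<close>

lemma exists_linear_relation:
  fixes e :: "nat \<Rightarrow> 'b \<Rightarrow> 'k :: field"
  assumes "finite S"
  obtains x k where "k \<le> card S" "x k \<noteq> 0" "\<And>b. b \<in> S \<Longrightarrow> (\<Sum>k\<le>card S. x k * e k b) = 0"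
proof -
  define v :: "nat \<Rightarrow> 'b \<Rightarrow>\<^sub>0 'k" where "v k = (\<Sum>b\<in>S. free_scale (e k b) (gen b))" for k
  have lv: "Poly_Mapping.lookup (v k) b = e k b" if "b \<in> S" for k b
    using that assms
    by (simp add: v_def lookup_sum lookup_single when_def if_distrib cong: if_cong)
  let ?K = "{..card S}"
  have "\<exists>x. (\<exists>k\<in>?K. x k \<noteq> 0) \<and> (\<Sum>k\<in>?K. free_scale (x k) (v k)) = 0"
  \<comment> \<open>Linear dependence is a property of the set of rows and does not see repetitions;
    two equal rows give the relation with coefficients 1 and -1.\<close>
  proof (cases "inj_on v ?K")
    case True
    have "v ` ?K \<subseteq> free.span (gen ` S)"
      unfolding v_def
      by (rule image_subsetI, rule free.span_sum, rule free.span_scale, rule free.span_base) simp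
    moreover have "card (gen ` S :: ('b \<Rightarrow>\<^sub>0 'k) set) \<le> card S" by (rule card_image_le[OF assms])
    ultimately have "free.dependent (v ` ?K)"
      using free.independent_span_bound[of "gen ` S" "v ` ?K"] assms card_image[OF True] by auto
    then obtain u w where "w \<in> v ` ?K" "u w \<noteq> 0" "(\<Sum>w\<in>v ` ?K. free_scale (u w) w) = 0"
      using free.dependent_finite[of "v ` ?K"] by auto
    thus ?thesis using sum.reindex[OF True, of "\<lambda>w. free_scale (u w) w"]
      by (intro exI[of _ "\<lambda>k. u (v k)"]) auto
  next
    case False
    then obtain i j where ij: "i \<in> ?K" "j \<in> ?K" "i \<noteq> j" "v i = v j" by (auto simp: inj_on_def)
    let ?x = "\<lambda>k. if k = i then 1 else if k = j then - 1 else 0 :: 'k"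
    have "(\<Sum>k\<in>?K. free_scale (?x k) (v k)) = (\<Sum>k\<in>{i, j}. free_scale (?x k) (v k))"
      by (rule sum.mono_neutral_right) (use ij in auto)
    also have "\<dots> = 0" using ij by simp
    finally show ?thesis using ij by (intro exI[of _ ?x]) auto
  qed
  then obtain x k where x: "k \<in> ?K" "x k \<noteq> 0" "(\<Sum>k\<in>?K. free_scale (x k) (v k)) = 0" by blast
  have "(\<Sum>k\<le>card S. x k * e k b) = 0" if "b \<in> S" for b
    using arg_cong[OF x(3), of "\<lambda>f. Poly_Mapping.lookup f b"] that by (simp add: lookup_sum lv)
  thus ?thesis using that x by blast
qed

locale kvspace_closed = kvspace M
  for M :: "('k :: alg_closed_field, 'p, 'm) module_scheme" (structure)
begin

text \<open>A root of \<open>p\<close> splits off a linear factor, which \<open>alg_shiftD\<close>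
  removes; in the end a nonzero constant is left. Algebraic closedness enters here.\<close>

lemma pact_algD:
  assumes D: "endo M D" and v: "v \<in> carrier M" and "pact D p v \<in> alg D" "p \<noteq> 0"
  shows "v \<in> alg D"
  using assms(3,4)
proof (induction "Polynomial.degree p" arbitrary: p)
  case 0
  then obtain c where p: "p = [:c:]" "c \<noteq> 0" using Polynomial.degree_eq_zeroE by (metis pCons_0_0)
  have "c \<odot> v \<in> alg D" using 0 v p by (simp add: pact_def)
  hence "(1 / c) \<odot> (c \<odot> v) \<in> alg D" by (rule lsub_smult[OF lsub_alg[OF D]])
  thus ?case using v p by (simp flip: smult_simps(3))
next
  case (Suc n)
  then obtain m where "poly p m = 0" using alg_closed_imp_poly_has_root[of p] by auto
  then obtain q where q: "p = [:-m, 1:] * q" using poly_eq_0_iff_dvd by blast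
  hence "q \<noteq> 0" using Suc.prems by auto
  hence "Polynomial.degree q = n" using Suc.hyps(2) q by (simp add: Polynomial.degree_mult_eq del: mult_pCons_left)
  moreover have "pact D q v \<in> alg D"
    using Suc.prems alg_shiftD[OF D pact_closed[OF D v]] unfolding q pact_linear_factor[OF D v] by blast
  ultimately show ?case using Suc.hyps(1) \<open>q \<noteq> 0\<close> by blast
qed

text \<open>Modulo \<open>alg D\<close> the span of the \<open>v b\<close> is finite-dimensional and \<open>D\<close>-invariant, hence zero.\<close>

lemma invariant_family_alg:
  assumes D: "endo M D" and S: "finite S" and v: "\<And>b. b \<in> S \<Longrightarrow> v b \<in> carrier M"
    and inv: "\<And>\<phi> b. \<phi> \<in> dual M \<Longrightarrow> (\<And>a. a \<in> alg D \<Longrightarrow> \<phi> a = 0) \<Longrightarrow> b \<in> S \<Longrightarrow>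
      \<phi> (D (v b)) = (\<Sum>b'\<in>S. c b b' * \<phi> (v b'))"
    and b: "b \<in> S"
  shows "v b \<in> alg D"
proof -
  \<comment> \<open>\<open>e k\<close> is the k-th power of the matrix \<open>c\<close>. Modulo
    \<open>alg D\<close>, its row \<open>b\<close> expresses D^k (v b) through the family
    \<open>v\<close>.\<close>
  define e where "e = rec_nat (\<lambda>b b'. if b = b' then 1 else 0) (\<lambda>_ f b b'. \<Sum>b''\<in>S. c b b'' * f b'' b')"
  have e: "e 0 b b' = (if b = b' then 1 else 0)" "e (Suc k) b b' = (\<Sum>b''\<in>S. c b b'' * e k b'' b')" for k b b'
    by (auto simp: e_def)
  have pow: "\<phi> ((D ^^ k) (v b)) = (\<Sum>b'\<in>S. e k b b' * \<phi> (v b'))"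
    if \<phi>: "\<phi> \<in> dual M" "\<And>a. a \<in> alg D \<Longrightarrow> \<phi> a = 0" and "b \<in> S" for \<phi> k b
    using \<open>b \<in> S\<close>
  proof (induction k arbitrary: b)
    case 0
    thus ?case using S by (simp add: e if_distrib[of "\<lambda>x. x * _"] cong: if_cong)
  next
    case (Suc k)
    have "(D ^^ k) a \<in> alg D" if "a \<in> alg D" for a
      using that by (induction k) (auto simp: endo_alg[OF D])
    \<comment> \<open>As \<open>alg D\<close> is invariant, \<open>\<phi> \<circ> (D ^^ k)\<close>
      vanishes on it too and \<open>inv\<close> applies to this functional.\<close>
    hence "(\<phi> \<circ> (D ^^ k)) (D (v b)) = (\<Sum>b''\<in>S. c b b'' * (\<phi> \<circ> (D ^^ k)) (v b''))"
      using \<phi> Suc.prems by (intro inv dual_endo[OF _ endo_funpow[OF D]]) auto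
    also have "\<dots> = (\<Sum>b''\<in>S. c b b'' * (\<Sum>b'\<in>S. e k b'' b' * \<phi> (v b')))"
      using Suc.IH by (intro sum.cong) auto
    also have "\<dots> = (\<Sum>b'\<in>S. e (Suc k) b b' * \<phi> (v b'))"
      by (simp add: e(2) sum_distrib_left sum_distrib_right mult.assoc) (rule sum.swap)
    finally show ?case by (simp add: funpow_swap1)
  qed
  \<comment> \<open>A relation between the rows with index \<open>b\<close> of the powers 0 to
    \<open>card S\<close> supplies the coefficients of a polynomial with p(D)(v b) in
    \<open>alg D\<close>. The family \<open>v\<close> itself may be dependent.\<close>
  obtain x k where x: "k \<le> card S" "x k \<noteq> 0" "\<And>b'. b' \<in> S \<Longrightarrow> (\<Sum>k\<le>card S. x k * e k b b') = 0"
    by (rule exists_linear_relation[OF S, of "\<lambda>k. e k b"]) blast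
  define p where "p = (\<Sum>k\<le>card S. Polynomial.monom (x k) k)"
  have cp: "Polynomial.coeff p k = (if k \<le> card S then x k else 0)" for k
    by (simp add: p_def Polynomial.coeff_sum)
  have "p \<noteq> 0" using x cp[of k] by auto
  have dp: "Polynomial.degree p \<le> card S" by (rule Polynomial.degree_le) (simp add: cp)
  have "pact D p (v b) \<in> alg D"
  proof (rule separation[OF lsub_alg[OF D] pact_closed[OF D v[OF b]]])
    fix \<phi> assume \<phi>: "\<phi> \<in> dual M" "\<And>a. a \<in> alg D \<Longrightarrow> \<phi> a = 0"
    have "\<phi> (pact D p (v b)) = (\<Sum>k\<le>card S. x k * (\<Sum>b'\<in>S. e k b b' * \<phi> (v b')))"
      using dual_pact[OF D v[OF b] \<phi>(1) dp] pow[OF \<phi> b] by (simp add: cp)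
    also have "\<dots> = (\<Sum>b'\<in>S. (\<Sum>k\<le>card S. x k * e k b b') * \<phi> (v b'))"
      by (simp add: sum_distrib_left sum_distrib_right mult.assoc) (rule sum.swap)
    also have "\<dots> = 0" using x(3) by simp
    finally show "\<phi> (pact D p (v b)) = 0" .
  qed
  thus ?thesis by (rule pact_algD[OF D v[OF b] _ \<open>p \<noteq> 0\<close>])
qed

end

section \<open>Sums of commuting operators\<close>

context kvspace
begin

lemma funpow_commute:
  assumes f: "endo M f" and g: "endo M g" and "\<And>x. x \<in> carrier M \<Longrightarrow> g (f x) = f (g x)" "x \<in> carrier M"
  shows "g ((f ^^ n) x) = (f ^^ n) (g x)"
proof (induction n)
  case (Suc n)
  show ?case using Suc assms(3)[OF endo_closed[OF endo_funpow[OF f] assms(4)]] by simp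
qed simp

text \<open>(C - m - c n) x = (A - m) x + c (B - n) x. An outer induction on the power of A - m
  handles the first term and an inner one along B - n the second, in place of a binomial expansion.
  It is applied with c = 1 to obtain \<open>G\<close> from \<open>G1\<close> and \<open>G2\<close>,
  and with c = -1 to recover \<open>G2\<close> from \<open>G\<close> and \<open>G1\<close>.\<close>

lemma geig_sum:
  assumes A: "endo M A" and B: "endo M B" and C: "endo M C"
    and comm: "\<And>x. x \<in> carrier M \<Longrightarrow> A (B x) = B (A x)"
    and C_eq: "\<And>x. x \<in> carrier M \<Longrightarrow> C x = A x \<oplus> c \<odot> B x"
    and x: "x \<in> geig M A m" "x \<in> geig M B n"
  shows "x \<in> geig M C (m + c * n)"
proof -
  let ?A = "shift M A m" and ?B = "shift M B n" and ?C = "shift M C (m + c * n)"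
  note GC = lsub_geig[OF C, of "m + c * n"]
  have c1: "?A (B x) = B (?A x)" if "x \<in> carrier M" for x
    using shift_commute[OF A B _ that] comm by simp
  have c2: "?A (?B x) = ?B (?A x)" if "x \<in> carrier M" for x
    by (rule shift_commute[OF B endo_shift[OF A] _ that]) (rule c1)
  have C': "?C x = ?A x \<oplus> c \<odot> ?B x" if "x \<in> carrier M" for x
    using that endo_closed[OF A that] endo_closed[OF B that] unfolding shift_def C_eq[OF that]
    by (intro eqI_dual) (auto simp: dual_simps algebra_simps)
  have "x \<in> geig M C (m + c * n)" if "(?A ^^ k) x = \<zero>" "x \<in> geig M B n" for k x
    using that
  proof (induction k arbitrary: x)
    case 0
    thus ?case using lsub_zero[OF GC] by simp
  next
    case (Suc k)
    from B Suc.prems(2,1) show ?case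
    proof (induction rule: geig_induct)
      case zero
      show ?case by (rule lsub_zero[OF GC])
    next
      case (shift x)
      have xC: "x \<in> carrier M" using shift(1) by (rule geig_carrier)
      have "(?A ^^ Suc k) (?B x) = ?B ((?A ^^ Suc k) x)"
        by (rule funpow_commute[OF endo_shift[OF A] endo_shift[OF B] _ xC, symmetric]) (rule c2[symmetric])
      hence "?B x \<in> geig M C (m + c * n)"
        using shift endo_zero[OF endo_shift[OF B]] by metis
      moreover have "?A x \<in> geig M B n"
        by (rule geig_commute[OF B endo_shift[OF A] _ shift(1)]) (rule c1)
      hence "?A x \<in> geig M C (m + c * n)"
        using Suc.IH[of "?A x"] shift.prems by (simp add: funpow_swap1)
      ultimately have "?C x \<in> geig M C (m + c * n)"
        unfolding C'[OF xC] by (intro lsub_add[OF GC] lsub_smult[OF GC])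
      thus ?case by (rule geig_shiftD[OF xC])
    qed
  qed
  thus ?thesis using x by (auto simp: geig_def)
qed

lemma addclo_finsum:
  assumes "\<And>i. i \<in> S \<Longrightarrow> f i \<in> addclo M Z" "Z \<subseteq> carrier M"
  shows "(\<Oplus>i\<in>S. f i) \<in> addclo M Z"
  using assms(1)
proof (induction S rule: infinite_finite_induct)
  case (insert i S)
  hence "f \<in> S \<rightarrow> carrier M" "f i \<in> carrier M" using addclo_carrier[OF _ assms(2)] by auto
  thus ?case using insert by (simp add: addclo.add)
qed (auto intro: addclo.zero)

end

section \<open>Tensor products of operators\<close>

text \<open>A tensor product described by bilinearity, generation by pure tensors, and the existence
  of \<phi> (x) \<psi> for functionals, which guarantees that no further relations hold. The
  description is symmetric in the factors, so \<open>flip\<close> transfers every result to the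
  other side.\<close>

locale tensor_pair =
  L: kvspace_closed M1 + R: kvspace_closed M2 + W: kvspace_closed T
  for M1 :: "('k :: alg_closed_field, 'a, 'm1) module_scheme"
    and M2 :: "('k, 'b, 'm2) module_scheme"
    and T :: "('k, 't, 'm3) module_scheme" +
  fixes \<tau> :: "'a \<Rightarrow> 'b \<Rightarrow> 't"
  assumes tau_closed: "a \<in> carrier M1 \<Longrightarrow> b \<in> carrier M2 \<Longrightarrow> \<tau> a b \<in> carrier T"
    and tau_add_left: "a \<in> carrier M1 \<Longrightarrow> a' \<in> carrier M1 \<Longrightarrow> b \<in> carrier M2 \<Longrightarrow>
      \<tau> (a \<oplus>\<^bsub>M1\<^esub> a') b = \<tau> a b \<oplus>\<^bsub>T\<^esub> \<tau> a' b"
    and tau_add_right: "a \<in> carrier M1 \<Longrightarrow> b \<in> carrier M2 \<Longrightarrow> b' \<in> carrier M2 \<Longrightarrow>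
      \<tau> a (b \<oplus>\<^bsub>M2\<^esub> b') = \<tau> a b \<oplus>\<^bsub>T\<^esub> \<tau> a b'"
    and tau_smult_left: "a \<in> carrier M1 \<Longrightarrow> b \<in> carrier M2 \<Longrightarrow> \<tau> (c \<odot>\<^bsub>M1\<^esub> a) b = c \<odot>\<^bsub>T\<^esub> \<tau> a b"
    and tau_smult_right: "a \<in> carrier M1 \<Longrightarrow> b \<in> carrier M2 \<Longrightarrow> \<tau> a (c \<odot>\<^bsub>M2\<^esub> b) = c \<odot>\<^bsub>T\<^esub> \<tau> a b"
    and tau_generates: "y \<in> carrier T \<Longrightarrow>
      y \<in> addclo T {\<tau> a b | a b. a \<in> carrier M1 \<and> b \<in> carrier M2}"
    and tau_dual: "\<phi> \<in> dual M1 \<Longrightarrow> \<psi> \<in> dual M2 \<Longrightarrow>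
      \<exists>\<theta>\<in>dual T. \<forall>a\<in>carrier M1. \<forall>b\<in>carrier M2. \<theta> (\<tau> a b) = \<phi> a * \<psi> b"
begin

lemma flip: "tensor_pair M2 M1 T (\<lambda>b a. \<tau> a b)"
proof unfold_locales
  fix y assume "y \<in> carrier T"
  from tau_generates[OF this]
  show "y \<in> addclo T {\<tau> b a | a b. a \<in> carrier M2 \<and> b \<in> carrier M1}"
    by (rule addclo_mono) (blast intro: addclo.base)
next
  fix \<phi> \<psi> assume "\<phi> \<in> dual M2" "\<psi> \<in> dual M1"
  from tau_dual[OF this(2,1)]
  show "\<exists>\<theta>\<in>dual T. \<forall>a\<in>carrier M2. \<forall>b\<in>carrier M1. \<theta> (\<tau> b a) = \<phi> a * \<psi> b"
    by (auto simp: mult.commute)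
qed (auto simp: tau_closed tau_add_left tau_add_right tau_smult_left tau_smult_right)

lemma tau_zero_left: "b \<in> carrier M2 \<Longrightarrow> \<tau> \<zero>\<^bsub>M1\<^esub> b = \<zero>\<^bsub>T\<^esub>"
  using tau_smult_left[of "\<zero>\<^bsub>M1\<^esub>" b 0] by (simp add: tau_closed)

lemma tau_zero_right: "a \<in> carrier M1 \<Longrightarrow> \<tau> a \<zero>\<^bsub>M2\<^esub> = \<zero>\<^bsub>T\<^esub>"
  using tau_smult_right[of a "\<zero>\<^bsub>M2\<^esub>" 0] by (simp add: tau_closed)

lemma tau_finsum_left:
  assumes "\<And>i. i \<in> S \<Longrightarrow> f i \<in> carrier M1" "b \<in> carrier M2"
  shows "\<tau> (\<Oplus>\<^bsub>M1\<^esub>i\<in>S. f i) b = (\<Oplus>\<^bsub>T\<^esub>i\<in>S. \<tau> (f i) b)"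
  using assms(1)
  by (induction S rule: infinite_finite_induct)
    (use assms(2) in \<open>auto simp: tau_zero_left tau_add_left tau_closed\<close>)

section \<open>Tensor products of subspaces\<close>

definition ts :: "'a set \<Rightarrow> 'b set \<Rightarrow> 't set" where
  "ts U V = addclo T {\<tau> u v | u v. u \<in> U \<and> v \<in> V}"

lemma ts_base: "u \<in> U \<Longrightarrow> v \<in> V \<Longrightarrow> \<tau> u v \<in> ts U V"
  unfolding ts_def by (rule addclo.base) auto

lemma ts_subset_lsub:
  assumes "y \<in> ts U V" "lsub T Y" "\<And>u v. u \<in> U \<Longrightarrow> v \<in> V \<Longrightarrow> \<tau> u v \<in> Y"
  shows "y \<in> Y"
  using assms(1) unfolding ts_def by (rule W.addclo_lsub[OF _ assms(2)]) (auto intro: assms(3))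

lemma lsub_ts:
  assumes "lsub M1 U" "lsub M2 V"
  shows "lsub T (ts U V)"
  unfolding ts_def
proof (rule W.addclo_smult_closed)
  note [simp] = L.lsub_carrier[OF assms(1)] R.lsub_carrier[OF assms(2)]
  show "{\<tau> u v |u v. u \<in> U \<and> v \<in> V} \<subseteq> carrier T" by (auto intro: tau_closed)
  fix c x assume "x \<in> {\<tau> u v |u v. u \<in> U \<and> v \<in> V}"
  then obtain u v where "x = \<tau> u v" "u \<in> U" "v \<in> V" by auto
  moreover from this have "c \<odot>\<^bsub>T\<^esub> x = \<tau> (c \<odot>\<^bsub>M1\<^esub> u) v" by (simp add: tau_smult_left)
  ultimately show "c \<odot>\<^bsub>T\<^esub> x \<in> {\<tau> u v |u v. u \<in> U \<and> v \<in> V}"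
    using L.lsub_smult[OF assms(1)] by blast
qed

text \<open>Links the inductive form, suited to proofs, with sums over an initial segment of the
  naturals, the form of \<open>tensor_subspace\<close>.\<close>

lemma ts_eq_finsum:
  assumes U: "U \<subseteq> carrier M1" and V: "V \<subseteq> carrier M2"
  shows "ts U V = {\<Oplus>\<^bsub>T\<^esub>i\<in>{..<n}. \<tau> (v i) (w i) | (n :: nat) v w. \<forall>i<n. v i \<in> U \<and> w i \<in> V}"
    (is "_ = ?S")
proof (rule subset_antisym; rule subsetI)
  fix y assume "y \<in> ?S"
  then obtain n v w where y: "y = (\<Oplus>\<^bsub>T\<^esub>i\<in>{..<n::nat}. \<tau> (v i) (w i))" "\<forall>i<n. v i \<in> U \<and> w i \<in> V" by auto
  have "{\<tau> u v |u v. u \<in> U \<and> v \<in> V} \<subseteq> carrier T" using U V by (auto intro: tau_closed)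
  thus "y \<in> ts U V" unfolding y(1) ts_def
    using y(2) by (intro W.addclo_finsum addclo.base) blast+
next
  have suc: "(\<Oplus>\<^bsub>T\<^esub>i\<in>{..<Suc n}. \<tau> (v i) (w i)) = \<tau> (v n) (w n) \<oplus>\<^bsub>T\<^esub> (\<Oplus>\<^bsub>T\<^esub>i\<in>{..<n}. \<tau> (v i) (w i))"
    if "\<forall>i<Suc n. v i \<in> U \<and> w i \<in> V" for n v w
    using that U V unfolding lessThan_Suc
    by (subst W.M.finsum_insert) (auto intro!: tau_closed)
  have one: "\<tau> a b \<oplus>\<^bsub>T\<^esub> y \<in> ?S" if ab: "a \<in> U" "b \<in> V" "y \<in> ?S" for a b y
  proof -
    from ab(3) obtain n v w where y: "y = (\<Oplus>\<^bsub>T\<^esub>i\<in>{..<n::nat}. \<tau> (v i) (w i))" "\<forall>i<n. v i \<in> U \<and> w i \<in> V"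
      by auto
    \<comment> \<open>The new pair is stored at index \<open>n\<close>, which the sum over
      \<open>{..<n}\<close> does not see.\<close>
    have "y = (\<Oplus>\<^bsub>T\<^esub>i\<in>{..<n}. \<tau> ((v(n := a)) i) ((w(n := b)) i))" unfolding y(1)
      by (rule W.M.finsum_cong') (use y(2) U V in \<open>auto intro!: tau_closed\<close>)
    hence "\<tau> a b \<oplus>\<^bsub>T\<^esub> y = (\<Oplus>\<^bsub>T\<^esub>i\<in>{..<Suc n}. \<tau> ((v(n := a)) i) ((w(n := b)) i))"
      using y(2) ab by (subst suc) (auto simp: less_Suc_eq)
    moreover have "\<forall>i<Suc n. (v(n := a)) i \<in> U \<and> (w(n := b)) i \<in> V"
      using y(2) ab by (auto simp: less_Suc_eq)
    ultimately show ?thesis by blast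
  qed
  have zero: "\<zero>\<^bsub>T\<^esub> \<in> ?S" by (intro CollectI exI[of _ 0]) auto
  have S_carrier: "y \<in> carrier T" if "y \<in> ?S" for y
    using that U V by (auto intro!: W.M.finsum_closed tau_closed)
  have add: "x \<oplus>\<^bsub>T\<^esub> y \<in> ?S" if "x \<in> ?S" "y \<in> ?S" for x y
  proof -
    have "(\<Oplus>\<^bsub>T\<^esub>i\<in>{..<n::nat}. \<tau> (v i) (w i)) \<oplus>\<^bsub>T\<^esub> y \<in> ?S" if "\<forall>i<n. v i \<in> U \<and> w i \<in> V" for n v w
      using that
    proof (induction n)
      case 0
      show ?case using \<open>y \<in> ?S\<close> S_carrier by simp
    next
      case (Suc n)
      have "(\<Oplus>\<^bsub>T\<^esub>i\<in>{..<n}. \<tau> (v i) (w i)) \<in> carrier T" "\<tau> (v n) (w n) \<in> carrier T"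
        using Suc.prems U V by (auto intro!: W.M.finsum_closed tau_closed)
      hence "(\<Oplus>\<^bsub>T\<^esub>i\<in>{..<Suc n}. \<tau> (v i) (w i)) \<oplus>\<^bsub>T\<^esub> y = \<tau> (v n) (w n) \<oplus>\<^bsub>T\<^esub> ((\<Oplus>\<^bsub>T\<^esub>i\<in>{..<n}. \<tau> (v i) (w i)) \<oplus>\<^bsub>T\<^esub> y)"
        using S_carrier[OF \<open>y \<in> ?S\<close>] unfolding suc[OF Suc.prems] by (simp add: W.M.a_assoc)
      moreover have "(\<Oplus>\<^bsub>T\<^esub>i\<in>{..<n}. \<tau> (v i) (w i)) \<oplus>\<^bsub>T\<^esub> y \<in> ?S" using Suc by auto
      ultimately show ?case using one Suc.prems by (metis (no_types, lifting) lessI)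
    qed
    thus ?thesis using that(1) by blast
  qed
  fix y assume "y \<in> ts U V"
  thus "y \<in> ?S" unfolding ts_def
  proof (induction rule: addclo.induct)
    case (base y)
    then obtain u v where uv: "y = \<tau> u v" "u \<in> U" "v \<in> V" by auto
    have "\<tau> u v \<oplus>\<^bsub>T\<^esub> \<zero>\<^bsub>T\<^esub> \<in> ?S" by (rule one[OF uv(2,3) zero])
    moreover have "\<tau> u v \<oplus>\<^bsub>T\<^esub> \<zero>\<^bsub>T\<^esub> = y"
      using uv U V W.M.r_zero[OF tau_closed[of u v]] by blast
    ultimately show ?case by (simp only:)
  qed (use zero add in auto)
qed

text \<open>Left factors are expanded in the basis and the scalars moved to the right; collecting
  terms leaves one right factor per basis vector.\<close>

lemma ts_expand:
  assumes B: "L.rel_basis {\<zero>\<^bsub>M1\<^esub>} U B \<phi>" and U: "lsub M1 U" and V: "lsub M2 V" and "y \<in> ts U V"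
  obtains S w where "finite S" "S \<subseteq> B" "\<forall>b\<in>B. w b \<in> V" "y = (\<Oplus>\<^bsub>T\<^esub>b\<in>S. \<tau> b (w b))"
proof -
  note VC = R.lsub_carrier[OF V]
  have BU: "B \<subseteq> U" using B by (simp add: L.rel_basis_def)
  hence BC: "b \<in> carrier M1" if "b \<in> B" for b using that L.lsub_carrier[OF U] by auto
  have "y \<in> addclo T (\<Union>b\<in>B. {\<tau> b v | v. v \<in> V})"
    using assms(4) unfolding ts_def
  proof (rule addclo_mono)
    fix x assume "x \<in> {\<tau> u v |u v. u \<in> U \<and> v \<in> V}"
    then obtain u v where x: "x = \<tau> u v" "u \<in> U" "v \<in> V" by auto
    let ?S = "{b \<in> B. \<phi> b u \<noteq> 0}"
    have S: "finite ?S" "u \<ominus>\<^bsub>M1\<^esub> (\<Oplus>\<^bsub>M1\<^esub>b\<in>?S. \<phi> b u \<odot>\<^bsub>M1\<^esub> b) = \<zero>\<^bsub>M1\<^esub>"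
      using B x(2) by (auto simp: L.rel_basis_def)
    have "(\<Oplus>\<^bsub>M1\<^esub>b\<in>?S. \<phi> b u \<odot>\<^bsub>M1\<^esub> b) \<in> carrier M1" using BC by (intro L.M.finsum_closed) auto
    hence "u = (\<Oplus>\<^bsub>M1\<^esub>b\<in>?S. \<phi> b u \<odot>\<^bsub>M1\<^esub> b)"
      using L.minus_eq_zeroD[OF L.lsub_carrier[OF U x(2)] _ S(2)] by simp
    hence "x = \<tau> (\<Oplus>\<^bsub>M1\<^esub>b\<in>?S. \<phi> b u \<odot>\<^bsub>M1\<^esub> b) v" using x(1) by simp
    also have "\<dots> = (\<Oplus>\<^bsub>T\<^esub>b\<in>?S. \<tau> (\<phi> b u \<odot>\<^bsub>M1\<^esub> b) v)"
      by (rule tau_finsum_left) (use BC VC x in auto)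
    also have "\<dots> = (\<Oplus>\<^bsub>T\<^esub>b\<in>?S. \<tau> b (\<phi> b u \<odot>\<^bsub>M2\<^esub> v))"
      by (rule W.M.finsum_cong') (use BC VC x in \<open>auto simp: tau_smult_left tau_smult_right tau_closed\<close>)
    also have "\<dots> \<in> addclo T (\<Union>b\<in>B. {\<tau> b v | v. v \<in> V})"
    proof (intro W.addclo_finsum addclo.base)
      fix b assume "b \<in> ?S"
      thus "\<tau> b (\<phi> b u \<odot>\<^bsub>M2\<^esub> v) \<in> (\<Union>b\<in>B. {\<tau> b v | v. v \<in> V})"
        using R.lsub_smult[OF V x(3), of "\<phi> b u"] by blast
    qed (use BC VC in \<open>auto intro: tau_closed\<close>)
    finally show "x \<in> addclo T (\<Union>b\<in>B. {\<tau> b v | v. v \<in> V})" .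
  qed
  then obtain S x where S: "finite S" "S \<subseteq> B" "\<forall>b\<in>B. x b \<in> {\<tau> b v | v. v \<in> V}" "y = (\<Oplus>\<^bsub>T\<^esub>b\<in>S. x b)"
  proof (rule W.addclo_Union_finsum)
    fix b x y assume b: "b \<in> B" "x \<in> {\<tau> b v | v. v \<in> V}" "y \<in> {\<tau> b v | v. v \<in> V}"
    then obtain v v' where v: "v \<in> V" "v' \<in> V" "x = \<tau> b v" "y = \<tau> b v'" by auto
    hence "x \<oplus>\<^bsub>T\<^esub> y = \<tau> b (v \<oplus>\<^bsub>M2\<^esub> v')" using b BC VC by (simp add: tau_add_right)
    thus "x \<oplus>\<^bsub>T\<^esub> y \<in> {\<tau> b v | v. v \<in> V}" using v R.lsub_add[OF V] by blast
  next
    fix b assume b: "b \<in> B"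
    show "{\<tau> b v | v. v \<in> V} \<subseteq> carrier T" using b BC VC by (auto intro: tau_closed)
    show "\<zero>\<^bsub>T\<^esub> \<in> {\<tau> b v | v. v \<in> V}"
      using tau_zero_right[OF BC[OF b]] R.lsub_zero[OF V] by force
  qed
  from S(3) have "\<forall>b\<in>B. \<exists>v\<in>V. x b = \<tau> b v" by auto
  then obtain w where w: "\<forall>b\<in>B. w b \<in> V \<and> x b = \<tau> b (w b)" by metis
  have "y = (\<Oplus>\<^bsub>T\<^esub>b\<in>S. \<tau> b (w b))" unfolding S(4)
    by (rule W.M.finsum_cong') (use w S(2) BC VC in \<open>auto intro!: tau_closed\<close>)
  thus ?thesis using that S w by blast
qed

text \<open>Functionals that do not vanish on \<open>a\<close> and on \<open>b\<close> have a tensor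
  product that does not vanish on the pure tensor.\<close>

lemma tau_nonzero:
  assumes "a \<in> carrier M1" "a \<noteq> \<zero>\<^bsub>M1\<^esub>" "b \<in> carrier M2" "b \<noteq> \<zero>\<^bsub>M2\<^esub>"
  shows "\<tau> a b \<noteq> \<zero>\<^bsub>T\<^esub>"
proof
  assume 0: "\<tau> a b = \<zero>\<^bsub>T\<^esub>"
  obtain \<phi> where \<phi>: "\<phi> \<in> dual M1" "\<phi> a \<noteq> 0"
    using L.eqI_dual[of a "\<zero>\<^bsub>M1\<^esub>"] L.dual_zero assms L.M.zero_closed by metis
  obtain \<psi> where \<psi>: "\<psi> \<in> dual M2" "\<psi> b \<noteq> 0"
    using R.eqI_dual[of b "\<zero>\<^bsub>M2\<^esub>"] R.dual_zero assms R.M.zero_closed by metis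
  from tau_dual[OF \<phi>(1) \<psi>(1)] obtain \<theta> where \<theta>: "\<theta> \<in> dual T" "\<theta> (\<tau> a b) = \<phi> a * \<psi> b"
    using assms by auto
  thus False using W.dual_zero[OF \<theta>(1)] \<phi>(2) \<psi>(2) by (simp add: 0)
qed

end

text \<open>\<open>G1\<close> and \<open>G2\<close> stand for D1 (x) 1 and 1 (x) D2, fixed by their
  values on pure tensors. The brackets with z1 (x) 1, 1 (x) z2 and \<Gamma> are substituted at the
  end.\<close>

locale tensor_ops = tensor_pair M1 M2 T \<tau>
  for M1 :: "('k :: alg_closed_field, 'a, 'm1) module_scheme"
    and M2 :: "('k, 'b, 'm2) module_scheme"
    and T :: "('k, 't, 'm3) module_scheme" and \<tau> +
  fixes D1 D2 G1 G2 G
  assumes D1: "endo M1 D1" and D2: "endo M2 D2"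
    and G1: "endo T G1" and G2: "endo T G2" and G: "endo T G"
    and G1_tau: "a \<in> carrier M1 \<Longrightarrow> b \<in> carrier M2 \<Longrightarrow> G1 (\<tau> a b) = \<tau> (D1 a) b"
    and G2_tau: "a \<in> carrier M1 \<Longrightarrow> b \<in> carrier M2 \<Longrightarrow> G2 (\<tau> a b) = \<tau> a (D2 b)"
    and G_eq: "y \<in> carrier T \<Longrightarrow> G y = G1 y \<oplus>\<^bsub>T\<^esub> G2 y"
begin

lemma flip_ops: "tensor_ops M2 M1 T (\<lambda>b a. \<tau> a b) D2 D1 G2 G1 G"
  by (intro tensor_ops.intro flip tensor_ops_axioms.intro)
    (auto simp: D1 D2 G1 G2 G G1_tau G2_tau G_eq W.M.a_comm W.endo_closed[OF G1] W.endo_closed[OF G2])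

lemmas D1C = L.endo_closed[OF D1] and D2C = R.endo_closed[OF D2]
  and G1C = W.endo_closed[OF G1] and G2C = W.endo_closed[OF G2]

lemma G1_G2_commute:
  assumes "y \<in> carrier T"
  shows "G1 (G2 y) = G2 (G1 y)"
proof -
  have "y \<in> addclo T {\<tau> a b | a b. a \<in> carrier M1 \<and> b \<in> carrier M2}"
    using assms by (rule tau_generates)
  thus ?thesis
  proof (induction rule: addclo.induct)
    case zero
    show ?case by (simp add: W.endo_zero[OF G1] W.endo_zero[OF G2])
  next
    case (base x)
    thus ?case by (auto simp: G1_tau G2_tau D1C D2C)
  next
    case (add x y)
    have "x \<in> carrier T" "y \<in> carrier T"
      using add W.addclo_carrier[of _ "{\<tau> a b | a b. a \<in> carrier M1 \<and> b \<in> carrier M2}"]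
      by (auto intro: tau_closed)
    thus ?case using add by (simp add: W.endo_add[OF G1] W.endo_add[OF G2] G1C G2C)
  qed
qed

lemma G_G1_commute:
  assumes "y \<in> carrier T"
  shows "G (G1 y) = G1 (G y)"
  using assms by (simp add: G_eq G1C G2C W.endo_add[OF G1] G1_G2_commute)

lemma shift_G1_tau:
  assumes "a \<in> carrier M1" "b \<in> carrier M2"
  shows "shift T G1 m (\<tau> a b) = \<tau> (shift M1 D1 m a) b"
  using assms
  by (simp add: shift_def G1_tau D1C tau_closed W.minus_eq_smult L.minus_eq_smult tau_add_left tau_smult_left)

lemma tau_geig_left:
  assumes "u \<in> geig M1 D1 m" "v \<in> carrier M2"
  shows "\<tau> u v \<in> geig T G1 m"
  using D1 assms(1)
proof (induction rule: L.geig_induct)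
  case zero
  show ?case using W.lsub_zero[OF W.lsub_geig[OF G1]] assms(2) by (simp add: tau_zero_left)
next
  case (shift u)
  thus ?case using assms(2) L.geig_carrier[OF shift(1)]
    by (intro W.geig_shiftD[of "\<tau> u v"] tau_closed) (auto simp: shift_G1_tau)
qed

lemma tau_geig_right: "u \<in> carrier M1 \<Longrightarrow> v \<in> geig M2 D2 m \<Longrightarrow> \<tau> u v \<in> geig T G2 m"
  by (rule tensor_ops.tau_geig_left[OF flip_ops])

lemma shift_G2_funpow_tau:
  assumes "a \<in> carrier M1" "b \<in> carrier M2"
  shows "(shift T G2 m ^^ n) (\<tau> a b) = \<tau> a ((shift M2 D2 m ^^ n) b)"
proof (induction n)
  case (Suc n)
  have "(shift M2 D2 m ^^ n) b \<in> carrier M2"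
    by (rule R.endo_closed[OF R.endo_funpow[OF R.endo_shift[OF D2]] assms(2)])
  thus ?case using Suc tensor_ops.shift_G1_tau[OF flip_ops _ assms(1)] by simp
qed simp

lemma ts_geig_left:
  assumes "y \<in> ts (geig M1 D1 m) V" "V \<subseteq> carrier M2"
  shows "y \<in> geig T G1 m"
  using assms(1) by (rule ts_subset_lsub[OF _ W.lsub_geig[OF G1]]) (use assms(2) tau_geig_left in auto)

lemma ts_geig:
  assumes "y \<in> ts (geig M1 D1 m) (geig M2 D2 (l - m))"
  shows "y \<in> geig T G l"
  using assms
proof (rule ts_subset_lsub[OF _ W.lsub_geig[OF G]])
  fix u v assume uv: "u \<in> geig M1 D1 m" "v \<in> geig M2 D2 (l - m)"
  hence "\<tau> u v \<in> geig T G (m + 1 * (l - m))"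
    by (intro W.geig_sum[OF G1 G2 G G1_G2_commute] tau_geig_left tau_geig_right)
      (auto simp: G_eq G2C L.geig_carrier R.geig_carrier)
  thus "\<tau> u v \<in> geig T G l" by simp
qed

section \<open>Generalised eigenvectors of the sum and their components\<close>

lemma ts_alg_shiftD:
  assumes y: "y \<in> carrier T" and sh: "shift T G l y \<in> ts (L.alg D1) (carrier M2)"
  shows "y \<in> ts (L.alg D1) (carrier M2)"
proof -
  interpret fl: tensor_pair M2 M1 T "\<lambda>b a. \<tau> a b" by (rule flip)
  \<comment> \<open>The basis is taken in the second factor and the coefficients \<open>v b\<close>
    lie in the first, while \<open>ts_expand\<close> keeps basis vectors on its left; hence the
    flipped pair.\<close>
  obtain B \<phi> where B: "R.rel_basis {\<zero>\<^bsub>M2\<^esub>} (carrier M2) B \<phi>"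
    using R.rel_basis_exists[OF R.lsub_0 R.lsub_carrier_self] by auto
  have "y \<in> fl.ts (carrier M2) (carrier M1)"
    unfolding fl.ts_def by (rule fl.tau_generates[OF y])
  then obtain S v where S: "finite S" "S \<subseteq> B" "\<forall>b\<in>B. v b \<in> carrier M1"
      "y = (\<Oplus>\<^bsub>T\<^esub>b\<in>S. \<tau> (v b) b)"
    by (rule fl.ts_expand[OF B R.lsub_carrier_self L.lsub_carrier_self])
  have BC: "b \<in> carrier M2" if "b \<in> B" for b using B that by (auto simp: R.rel_basis_def)
  have vC: "v b \<in> carrier M1" "b \<in> carrier M2" if "b \<in> S" for b using S BC that by auto
  have "v b \<in> L.alg D1" if "b \<in> S" for b
  proof (rule L.invariant_family_alg[OF D1 S(1) vC(1) _ that])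
    fix \<psi> b assume \<psi>: "\<psi> \<in> dual M1" "\<And>a. a \<in> L.alg D1 \<Longrightarrow> \<psi> a = 0" and b: "b \<in> S"
    have "\<phi> b \<in> dual M2" using B S(2) b by (auto simp: R.rel_basis_def)
    \<comment> \<open>\<open>\<theta>\<close> is \<psi> (x) \<phi> b: it annihilates
      \<open>ts (L.alg D1) (carrier M2)\<close> and reads off \<psi> of the coefficient at
      \<open>b\<close>.\<close>
    with tau_dual[OF \<psi>(1)] obtain \<theta> where \<theta>: "\<theta> \<in> dual T"
      "\<And>a c. a \<in> carrier M1 \<Longrightarrow> c \<in> carrier M2 \<Longrightarrow> \<theta> (\<tau> a c) = \<psi> a * \<phi> b c" by blast
    have \<phi>b: "\<phi> b b' = (if b = b' then 1 else 0)" if "b' \<in> S" for b'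
      using B S(2) b that unfolding R.rel_basis_def by (meson subsetD)
    have "\<theta> x = 0" if "x \<in> ts (L.alg D1) (carrier M2)" for x
      using that unfolding ts_def
    proof (induction rule: addclo.induct)
      case (base x)
      thus ?case using \<theta>(2) \<psi>(2) L.lsub_carrier[OF L.lsub_alg[OF D1]] by auto
    next
      case (add x z)
      hence "x \<in> carrier T" "z \<in> carrier T"
        using L.lsub_carrier[OF L.lsub_alg[OF D1]]
        by (auto intro: tau_closed elim!: W.addclo_carrier)
      thus ?case using add by (simp add: W.dual_add[OF \<theta>(1)])
    qed (rule W.dual_zero[OF \<theta>(1)])
    from this[OF sh] have t0: "\<theta> (G1 y) + \<theta> (G2 y) - l * \<theta> y = 0"
      using y by (simp add: shift_def G_eq W.dual_simps[OF \<theta>(1)] G1C G2C)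
    have t1: "\<theta> (G1 y) = (\<Sum>b'\<in>S. \<psi> (D1 (v b')) * \<phi> b b')"
      unfolding S(4) using vC
      by (simp add: W.endo_finsum[OF G1] tau_closed W.dual_finsum[OF \<theta>(1)] G1_tau \<theta>(2) D1C)
    have t2: "\<theta> (G2 y) = (\<Sum>b'\<in>S. \<psi> (v b') * \<phi> b (D2 b'))"
      unfolding S(4) using vC
      by (simp add: W.endo_finsum[OF G2] tau_closed W.dual_finsum[OF \<theta>(1)] G2_tau \<theta>(2) D2C)
    have t3: "\<theta> y = (\<Sum>b'\<in>S. \<psi> (v b') * \<phi> b b')"
      unfolding S(4) using vC by (simp add: tau_closed W.dual_finsum[OF \<theta>(1)] \<theta>(2))
    have dlt: "(\<Sum>b'\<in>S. f b' * \<phi> b b') = f b" for f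
    proof -
      have "(\<Sum>b'\<in>S. f b' * \<phi> b b') = (\<Sum>b'\<in>S. if b = b' then f b' else 0)"
        by (rule sum.cong) (simp_all add: \<phi>b)
      thus ?thesis using b S(1) by simp
    qed
    \<comment> \<open>The matrix is l times the identity minus that of \<open>D2\<close>, cut down
      to \<open>S\<close>. Basis vectors outside \<open>S\<close> that occur in \<open>D2 b'\<close>
      are invisible to \<open>\<phi> b\<close> with \<open>b\<close> in \<open>S\<close>.\<close>
    have "\<psi> (D1 (v b)) = l * \<psi> (v b) - (\<Sum>b'\<in>S. \<psi> (v b') * \<phi> b (D2 b'))"
      using t0 unfolding t1 t2 t3 dlt by (simp add: eq_diff_eq)
    also have "\<dots> = (\<Sum>b'\<in>S. (l * (if b = b' then 1 else 0) - \<phi> b (D2 b')) * \<psi> (v b'))"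
    proof -
      have "l * \<psi> (v b) - (\<Sum>b'\<in>S. \<psi> (v b') * \<phi> b (D2 b')) =
          (\<Sum>b'\<in>S. (if b = b' then l * \<psi> (v b') else 0) - \<psi> (v b') * \<phi> b (D2 b'))"
        using S(1) b by (simp add: sum_subtractf)
      also have "\<dots> = (\<Sum>b'\<in>S. (l * (if b = b' then 1 else 0) - \<phi> b (D2 b')) * \<psi> (v b'))"
        by (rule sum.cong) (auto simp: algebra_simps)
      finally show ?thesis .
    qed
    finally show "\<psi> (D1 (v b)) = (\<Sum>b'\<in>S. (l * (if b = b' then 1 else 0) - \<phi> b (D2 b')) * \<psi> (v b'))" .
  qed
  thus ?thesis unfolding S(4)
    using vC by (intro W.lsub_finsum[OF lsub_ts[OF L.lsub_alg[OF D1] R.lsub_carrier_self]] ts_base)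
qed

lemma geig_ts_alg:
  assumes "y \<in> geig T G l"
  shows "y \<in> ts (L.alg D1) (carrier M2)"
  using G assms
proof (induction rule: W.geig_induct)
  case zero
  show ?case unfolding ts_def by (rule addclo.zero)
next
  case (shift y)
  show ?case by (rule ts_alg_shiftD[OF W.geig_carrier[OF shift(1)] shift(3)])
qed

text \<open>A power of 1 (x) (D2 - m) acts on the sum of the b (x) w b through the right factors
  alone. If it kills the sum, applying \<phi> b (x) \<psi> for all \<psi> shows that the same power
  of D2 - m kills each \<open>w b\<close>.\<close>

lemma ts_geig_right:
  assumes U: "lsub M1 U" and y: "y \<in> ts U (carrier M2)" "y \<in> geig T G2 m"
  shows "y \<in> ts U (geig M2 D2 m)"
proof -
  obtain B \<phi> where B: "L.rel_basis {\<zero>\<^bsub>M1\<^esub>} U B \<phi>"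
    using L.rel_basis_exists[OF L.lsub_0 U] L.lsub_zero[OF U] by auto
  obtain S w where S: "finite S" "S \<subseteq> B" "\<forall>b\<in>B. w b \<in> carrier M2" "y = (\<Oplus>\<^bsub>T\<^esub>b\<in>S. \<tau> b (w b))"
    by (rule ts_expand[OF B U R.lsub_carrier_self y(1)])
  have SU: "b \<in> U" if "b \<in> S" for b using B S(2) that by (auto simp: L.rel_basis_def)
  hence C: "b \<in> carrier M1" "w b \<in> carrier M2" if "b \<in> S" for b
    using S(2,3) L.lsub_carrier[OF U] that by auto
  obtain n where n: "(shift T G2 m ^^ n) y = \<zero>\<^bsub>T\<^esub>" using y(2) by (auto simp: geig_def)
  let ?E = "shift M2 D2 m ^^ n"
  note E = R.endo_closed[OF R.endo_funpow[OF R.endo_shift[OF D2]]]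
  have "w b \<in> geig M2 D2 m" if b: "b \<in> S" for b
  proof -
    have "?E (w b) = \<zero>\<^bsub>M2\<^esub>"
    proof (rule R.eqI_dual)
      fix \<psi> assume \<psi>: "\<psi> \<in> dual M2"
      have "\<phi> b \<in> dual M1" using B S(2) b by (auto simp: L.rel_basis_def)
      with tau_dual[OF _ \<psi>] obtain \<theta> where \<theta>: "\<theta> \<in> dual T"
        "\<And>a c. a \<in> carrier M1 \<Longrightarrow> c \<in> carrier M2 \<Longrightarrow> \<theta> (\<tau> a c) = \<phi> b a * \<psi> c" by blast
      have "(shift T G2 m ^^ n) y = (\<Oplus>\<^bsub>T\<^esub>b\<in>S. (shift T G2 m ^^ n) (\<tau> b (w b)))"
        unfolding S(4) using C
        by (intro W.endo_finsum[OF W.endo_funpow[OF W.endo_shift[OF G2]]] tau_closed)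
      also have "\<dots> = (\<Oplus>\<^bsub>T\<^esub>b\<in>S. \<tau> b (?E (w b)))"
        using C E by (intro W.M.finsum_cong') (auto simp: shift_G2_funpow_tau intro!: tau_closed)
      finally have "(\<Oplus>\<^bsub>T\<^esub>b\<in>S. \<tau> b (?E (w b))) = \<zero>\<^bsub>T\<^esub>" using n by simp
      hence "0 = \<theta> (\<Oplus>\<^bsub>T\<^esub>b\<in>S. \<tau> b (?E (w b)))" using W.dual_zero[OF \<theta>(1)] by simp
      also have "\<dots> = (\<Sum>b'\<in>S. \<phi> b b' * \<psi> (?E (w b')))"
        using C E by (simp add: W.dual_finsum[OF \<theta>(1)] tau_closed \<theta>(2))
      also have "\<dots> = (\<Sum>b'\<in>S. if b = b' then \<psi> (?E (w b')) else 0)"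
      proof (rule sum.cong[OF refl])
        fix b' assume "b' \<in> S"
        hence "\<phi> b b' = (if b = b' then 1 else 0)"
          using B S(2) b unfolding L.rel_basis_def by (meson subsetD)
        thus "\<phi> b b' * \<psi> (?E (w b')) = (if b = b' then \<psi> (?E (w b')) else 0)" by simp
      qed
      also have "\<dots> = \<psi> (?E (w b))" using S(1) b by simp
      finally show "\<psi> (?E (w b)) = \<psi> \<zero>\<^bsub>M2\<^esub>" using R.dual_zero[OF \<psi>] by simp
    qed (use C E b in auto)
    thus ?thesis using C b unfolding geig_def by blast
  qed
  thus ?thesis unfolding S(4)
    using SU by (intro W.lsub_finsum[OF lsub_ts[OF U R.lsub_geig[OF D2]]] ts_base)
qed

lemma geig_decompose:
  assumes y: "y \<in> geig T G l"
  obtains J x where "finite J" "\<forall>m\<in>J. x m \<in> ts (geig M1 D1 m) (geig M2 D2 (l - m))"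
    "y = (\<Oplus>\<^bsub>T\<^esub>m\<in>J. x m)"
proof -
  let ?S = "\<lambda>m. ts (geig M1 D1 m) (carrier M2)"
  have lS: "lsub T (?S m)" for m by (rule lsub_ts[OF L.lsub_geig[OF D1] R.lsub_carrier_self])
  have SC: "(\<Union>m\<in>UNIV. ?S m) \<subseteq> carrier T" using W.lsub_carrier[OF lS] by auto
  have "y \<in> addclo T (\<Union>m\<in>UNIV. ?S m)"
    using geig_ts_alg[OF y] unfolding ts_def
  proof (rule addclo_mono, fold ts_def)
    fix x assume "x \<in> {\<tau> u v |u v. u \<in> L.alg D1 \<and> v \<in> carrier M2}"
    then obtain u v where x: "x = \<tau> u v" "u \<in> L.alg D1" "v \<in> carrier M2" by auto
    show "x \<in> addclo T (\<Union>m\<in>UNIV. ?S m)" using x(2) unfolding L.alg_def x(1)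
    proof (induction rule: addclo.induct)
      case zero
      show ?case using x(3) by (simp add: tau_zero_left addclo.zero)
    next
      case (base u)
      thus ?case using x(3) by (auto intro!: addclo.base ts_base)
    next
      case (add u u')
      hence "u \<in> carrier M1" "u' \<in> carrier M1"
        by (auto elim!: L.addclo_carrier simp: geig_def)
      thus ?case using add x(3) by (simp add: tau_add_left addclo.add)
    qed
  qed
  then obtain J x where J: "finite J" "J \<subseteq> UNIV" "\<forall>m\<in>UNIV. x m \<in> ?S m" "y = (\<Oplus>\<^bsub>T\<^esub>m\<in>J. x m)"
    by (rule W.addclo_Union_finsum) (use lS in \<open>auto intro: W.lsub_carrier W.lsub_zero W.lsub_add\<close>)
  have xS: "x m \<in> ?S m" for m using J(3) by simp
  have xG1: "x m \<in> geig T G1 m" for m by (rule ts_geig_left[OF xS subset_refl])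
  have xC: "x m \<in> carrier T" for m by (rule W.geig_carrier[OF xG1])
  obtain n where n: "(shift T G l ^^ n) y = \<zero>\<^bsub>T\<^esub>" using y by (auto simp: geig_def)
  let ?E = "shift T G l ^^ n"
  note E = W.endo_funpow[OF W.endo_shift[OF G]]
  have "x m \<in> ts (geig M1 D1 m) (geig M2 D2 (l - m))" if m: "m \<in> J" for m
  proof -
    have "?E z \<in> geig T G1 i" if z: "z \<in> geig T G1 i" for z i
    proof (rule W.geig_commute[OF G1 E _ z])
      fix w assume w: "w \<in> carrier T"
      have "G1 (?E w) = ?E (G1 w)"
      proof (rule W.funpow_commute[OF W.endo_shift[OF G] G1 _ w])
        show "G1 (shift T G l u) = shift T G l (G1 u)" if "u \<in> carrier T" for u
          by (rule W.shift_commute[OF G G1 G_G1_commute[symmetric] that])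
      qed
      thus "?E (G1 w) = G1 (?E w)" by simp
    qed
    \<comment> \<open>One power of G - l kills \<open>y\<close> and preserves every generalised
      eigenspace of \<open>G1\<close>; independence makes it kill each component.\<close>
    moreover have "(\<Oplus>\<^bsub>T\<^esub>i\<in>J. ?E (x i)) = \<zero>\<^bsub>T\<^esub>"
      using n xC unfolding J(4) by (simp add: W.endo_finsum[OF E])
    ultimately have "?E (x m) = \<zero>\<^bsub>T\<^esub>"
      using W.geig_independent[OF G1 J(1), of "\<lambda>i. ?E (x i)" m] xG1 m by blast
    hence xG: "x m \<in> geig T G l" using xC unfolding geig_def by blast
    \<comment> \<open>G2 = G - G1 is a combination of commuting operators, so the eigenvalues
      subtract.\<close>
    have "x m \<in> geig T G2 (l + (- 1) * m)"
    proof (rule W.geig_sum[OF G G1 G2 G_G1_commute _ xG xG1])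
      show "G2 z = G z \<oplus>\<^bsub>T\<^esub> (- 1) \<odot>\<^bsub>T\<^esub> G1 z" if "z \<in> carrier T" for z
        using that by (intro W.eqI_dual) (auto simp: G_eq G1C G2C W.dual_simps)
    qed
    hence "x m \<in> geig T G2 (l - m)" by simp
    thus ?thesis by (rule ts_geig_right[OF L.lsub_geig[OF D1] xS])
  qed
  thus ?thesis using that J by blast
qed

lemma ts_independent:
  assumes "finite J" "\<And>m. m \<in> J \<Longrightarrow> x m \<in> ts (geig M1 D1 m) (geig M2 D2 (l - m))"
    "(\<Oplus>\<^bsub>T\<^esub>m\<in>J. x m) = \<zero>\<^bsub>T\<^esub>" "m \<in> J"
  shows "x m = \<zero>\<^bsub>T\<^esub>"
  by (rule W.geig_independent[OF G1 assms(1) _ assms(3,4)])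
    (rule ts_geig_left[OF assms(2)], auto simp: geig_def)

end

section \<open>The tensor product of two vector spaces\<close>

locale tensor_factors = L: kvspace P1 + R: kvspace P2
  for P1 :: "('k :: field, 'a) nc_poisson" and P2 :: "('k, 'b) nc_poisson"
begin

abbreviation "rel \<equiv> tensor_relations P1 P2"
abbreviation "C12 \<equiv> carrier P1 \<times> carrier P2"
abbreviation "cls \<equiv> tcoset P1 P2"
abbreviation "tau \<equiv> pure_tensor P1 P2"

lemma subspace_rel: "free.subspace rel"
  unfolding tensor_relations_def by (rule free.subspace_span)

text \<open>The preimage of \<open>Y\<close> under a linear map is a subspace, so containing
  \<open>rel\<close> is tested on the four families of relations. \<open>Y\<close> is
  \<open>{0}\<close> for functionals on the tensor product and \<open>rel\<close> for operations on
  it.\<close>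

lemma rel_induct:
  assumes s: "vector_space s" and f: "Vector_Spaces.linear free_scale s f"
    and Y: "module.subspace s Y"
    and "\<And>a a' b. a \<in> carrier P1 \<Longrightarrow> a' \<in> carrier P1 \<Longrightarrow> b \<in> carrier P2 \<Longrightarrow>
      f (gen (a \<oplus>\<^bsub>P1\<^esub> a', b)) - f (gen (a, b)) - f (gen (a', b)) \<in> Y"
    and "\<And>a b b'. a \<in> carrier P1 \<Longrightarrow> b \<in> carrier P2 \<Longrightarrow> b' \<in> carrier P2 \<Longrightarrow>
      f (gen (a, b \<oplus>\<^bsub>P2\<^esub> b')) - f (gen (a, b)) - f (gen (a, b')) \<in> Y"
    and "\<And>c a b. a \<in> carrier P1 \<Longrightarrow> b \<in> carrier P2 \<Longrightarrow>
      f (gen (c \<odot>\<^bsub>P1\<^esub> a, b)) - s c (f (gen (a, b))) \<in> Y"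
    and "\<And>c a b. a \<in> carrier P1 \<Longrightarrow> b \<in> carrier P2 \<Longrightarrow>
      f (gen (a, c \<odot>\<^bsub>P2\<^esub> b)) - s c (f (gen (a, b))) \<in> Y"
    and r: "r \<in> rel"
  shows "f r \<in> Y"
proof -
  interpret s: vector_space s by fact
  interpret f: Vector_Spaces.linear free_scale s f by fact
  have "rel \<subseteq> {r. f r \<in> Y}"
    unfolding tensor_relations_def
    by (rule free.span_minimal[OF _ f.subspace_linear_preimage[OF Y]])
      (auto simp: f.diff f.scale intro: assms(4-7))
  thus ?thesis using r by auto
qed

lemma rel_gens:
  assumes "a \<in> carrier P1" "b \<in> carrier P2"
  shows "a' \<in> carrier P1 \<Longrightarrow> gen (a \<oplus>\<^bsub>P1\<^esub> a', b) - gen (a, b) - gen (a', b) \<in> rel"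
    and "b' \<in> carrier P2 \<Longrightarrow> gen (a, b \<oplus>\<^bsub>P2\<^esub> b') - gen (a, b) - gen (a, b') \<in> rel"
    and "gen (c \<odot>\<^bsub>P1\<^esub> a, b) - free_scale c (gen (a, b)) \<in> rel"
    and "gen (a, c \<odot>\<^bsub>P2\<^esub> b) - free_scale c (gen (a, b)) \<in> rel"
  unfolding tensor_relations_def by (rule free.span_base; use assms in blast)+

lemma rel_free_on: "r \<in> rel \<Longrightarrow> r \<in> free_on C12"
proof -
  note fo = free.subspace_diff[OF subspace_free_on] free.subspace_scale[OF subspace_free_on] gen_in_free_on
  have "rel \<subseteq> free_on C12"
    unfolding tensor_relations_def
    by (rule free.span_minimal[OF _ subspace_free_on]) (auto intro!: fo)
  thus "r \<in> rel \<Longrightarrow> r \<in> free_on C12" by blast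
qed

section \<open>Cosets of the relations\<close>

lemma mem_cls: "f \<in> cls g \<longleftrightarrow> f - g \<in> rel"
  unfolding tcoset_def by (auto simp: image_iff) (metis add.commute diff_add_cancel)

lemma cls_eq_iff: "cls f = cls g \<longleftrightarrow> f - g \<in> rel"
proof
  assume "cls f = cls g"
  moreover have "f \<in> cls f" using free.subspace_0[OF subspace_rel] by (simp add: mem_cls)
  ultimately show "f - g \<in> rel" by (simp add: mem_cls)
next
  assume fg: "f - g \<in> rel"
  have "h - f \<in> rel \<longleftrightarrow> h - g \<in> rel" for h
    using free.subspace_add[OF subspace_rel _ fg, of "h - f"] free.subspace_diff[OF subspace_rel _ fg, of "h - g"]
    by auto
  thus "cls f = cls g" by (auto simp: mem_cls)
qed

lemma cls_self: "f \<in> cls f"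
  using free.subspace_0[OF subspace_rel] by (simp add: mem_cls)

lemma UN_cls:
  assumes "\<And>f'. f' \<in> cls f \<Longrightarrow> q f' = q f"
  shows "(\<Union>f'\<in>cls f. q f') = q f"
  using assms cls_self by blast

lemma tlift2_cls:
  assumes "\<And>f' g'. f' - f \<in> rel \<Longrightarrow> g' - g \<in> rel \<Longrightarrow> op f' g' - op f g \<in> rel"
  shows "tlift2 P1 P2 op (cls f) (cls g) = cls (op f g)"
proof -
  have "cls (op f' g') = cls (op f g)" if "f' \<in> cls f" "g' \<in> cls g" for f' g'
    using that assms by (simp add: mem_cls cls_eq_iff)
  hence "tlift2 P1 P2 op (cls f) (cls g) = (\<Union>f'\<in>cls f. \<Union>g'\<in>cls g. cls (op f g))"
    by (simp add: tlift2_def)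
  thus ?thesis using cls_self by blast
qed

lemma add_cls: "tlift2 P1 P2 (+) (cls f) (cls g) = cls (f + g)"
proof (rule tlift2_cls)
  fix f' g' assume "f' - f \<in> rel" "g' - g \<in> rel"
  from free.subspace_add[OF subspace_rel this] show "f' + g' - (f + g) \<in> rel"
    by (simp add: algebra_simps)
qed

lemma smult_cls: "(\<Union>f'\<in>cls f. cls (free_scale c f')) = cls (free_scale c f)"
proof (rule UN_cls)
  fix f' assume "f' \<in> cls f"
  hence "free_scale c (f' - f) \<in> rel" by (intro free.subspace_scale[OF subspace_rel]) (simp add: mem_cls)
  thus "cls (free_scale c f') = cls (free_scale c f)"
    by (simp add: cls_eq_iff free.scale_right_diff_distrib)
qed

text \<open>Stated through the record fields in order to cover two structures:
  \<open>tensor_algebra\<close>, in which the commutator bracket subtracts, and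
  \<open>poisson_tensor\<close> itself.\<close>

lemma kvspace_cosets:
  fixes M :: "('k, ('a \<times> 'b \<Rightarrow>\<^sub>0 'k) set, 'm) module_scheme"
  assumes c: "carrier M = cls ` free_on C12" and a: "ring.add M = tlift2 P1 P2 (+)"
    and z: "ring.zero M = cls 0"
    and s: "module.smult M = (\<lambda>c A. \<Union>f\<in>A. cls (free_scale c f))"
  shows "kvspace M"
proof -
  note fo = free.subspace_add[OF subspace_free_on] free.subspace_scale[OF subspace_free_on]
    free.subspace_0[OF subspace_free_on] free.subspace_neg[OF subspace_free_on]
  have "abelian_group M"
  proof (rule abelian_groupI)
    fix x assume "x \<in> carrier M"
    then obtain f where f: "f \<in> free_on C12" "x = cls f" by (auto simp: c)
    have "cls (- f) \<in> carrier M" "cls (- f) \<oplus>\<^bsub>M\<^esub> x = \<zero>\<^bsub>M\<^esub>"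
      unfolding c using f(1) by (simp_all add: f(2) a z add_cls fo)
    thus "\<exists>y\<in>carrier M. y \<oplus>\<^bsub>M\<^esub> x = \<zero>\<^bsub>M\<^esub>" by blast
  qed (auto simp: c a z add_cls add_ac fo)
  moreover have s': "x \<odot>\<^bsub>M\<^esub> cls f = cls (free_scale x f)" for x f
    by (simp only: s smult_cls)
  ultimately show ?thesis
    by (intro kvspace.intro moduleI)
      (auto simp: c a z s' add_cls free.scale_right_distrib free.scale_left_distrib fo)
qed

lemma tensor_algebra_fields:
  "carrier (tensor_algebra P1 P2) = cls ` free_on C12"
  "ring.add (tensor_algebra P1 P2) = tlift2 P1 P2 (+)"
  "ring.zero (tensor_algebra P1 P2) = cls 0"
  "module.smult (tensor_algebra P1 P2) = (\<lambda>c A. \<Union>f\<in>A. cls (free_scale c f))"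
  by (simp_all add: tensor_algebra_def)

abbreviation "T \<equiv> poisson_tensor P1 P2"

lemma poisson_tensor_fields:
  "carrier T = cls ` free_on C12" "ring.add T = tlift2 P1 P2 (+)" "ring.zero T = cls 0"
  "module.smult T = (\<lambda>c A. \<Union>f\<in>A. cls (free_scale c f))"
  "pbracket T = (if class_1 P1 \<and> class_1 P2 then class_1_bracket P1 P2 else commutator_bracket P1 P2)"
  by (simp_all add: poisson_tensor_def module.defs nc_poisson.defs tensor_algebra_def)

sublocale A: kvspace "tensor_algebra P1 P2"
  by (rule kvspace_cosets) (rule tensor_algebra_fields)+

sublocale W: kvspace T
  by (rule kvspace_cosets) (rule poisson_tensor_fields)+

lemma T_simps:
  "cls f \<oplus>\<^bsub>T\<^esub> cls g = cls (f + g)" "c \<odot>\<^bsub>T\<^esub> cls f = cls (free_scale c f)" "\<zero>\<^bsub>T\<^esub> = cls 0"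
  "f \<in> free_on C12 \<Longrightarrow> cls f \<in> carrier T"
  unfolding poisson_tensor_fields smult_cls add_cls by auto

lemma tensor_algebra_minus:
  assumes "f \<in> free_on C12" "g \<in> free_on C12"
  shows "cls f \<ominus>\<^bsub>tensor_algebra P1 P2\<^esub> cls g = cls (f - g)"
proof -
  have "cls f \<ominus>\<^bsub>tensor_algebra P1 P2\<^esub> cls g = cls f \<oplus>\<^bsub>tensor_algebra P1 P2\<^esub> (- 1) \<odot>\<^bsub>tensor_algebra P1 P2\<^esub> cls g"
    using assms by (intro A.minus_eq_smult) (auto simp: tensor_algebra_fields)
  thus ?thesis unfolding tensor_algebra_fields(2,4) smult_cls add_cls by simp
qed

lemma carrier_T_E:
  assumes "y \<in> carrier T"
  obtains f where "f \<in> free_on C12" "y = cls f"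
  using assms by (auto simp: poisson_tensor_fields)

lemma tau_in: "a \<in> carrier P1 \<Longrightarrow> b \<in> carrier P2 \<Longrightarrow> tau a b \<in> carrier T"
  unfolding pure_tensor_def by (intro T_simps gen_in_free_on) auto

lemma tau_bilinear:
  assumes "a \<in> carrier P1" "b \<in> carrier P2"
  shows "a' \<in> carrier P1 \<Longrightarrow> tau (a \<oplus>\<^bsub>P1\<^esub> a') b = tau a b \<oplus>\<^bsub>T\<^esub> tau a' b"
    and "b' \<in> carrier P2 \<Longrightarrow> tau a (b \<oplus>\<^bsub>P2\<^esub> b') = tau a b \<oplus>\<^bsub>T\<^esub> tau a b'"
    and "tau (c \<odot>\<^bsub>P1\<^esub> a) b = c \<odot>\<^bsub>T\<^esub> tau a b"
    and "tau a (c \<odot>\<^bsub>P2\<^esub> b) = c \<odot>\<^bsub>T\<^esub> tau a b"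
  using rel_gens[OF assms] unfolding pure_tensor_def T_simps cls_eq_iff
  by (simp_all add: diff_diff_eq)

lemma tau_generates:
  assumes "y \<in> carrier T"
  shows "y \<in> addclo T {tau a b | a b. a \<in> carrier P1 \<and> b \<in> carrier P2}" (is "_ \<in> ?S")
proof -
  have S: "lsub T ?S"
  proof (rule W.addclo_smult_closed)
    fix c x assume "x \<in> {tau a b | a b. a \<in> carrier P1 \<and> b \<in> carrier P2}"
    then obtain a b where "x = tau a b" "a \<in> carrier P1" "b \<in> carrier P2" by auto
    moreover from this have "c \<odot>\<^bsub>T\<^esub> x = tau (c \<odot>\<^bsub>P1\<^esub> a) b" by (simp add: tau_bilinear)
    ultimately show "c \<odot>\<^bsub>T\<^esub> x \<in> {tau a b | a b. a \<in> carrier P1 \<and> b \<in> carrier P2}" by blast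
  qed (auto intro: tau_in)
  have "free.subspace {f. cls f \<in> ?S}"
    using W.lsub_simps[OF S] by (intro free.subspaceI) (auto simp flip: T_simps)
  moreover have "gen ` C12 \<subseteq> {f. cls f \<in> ?S}"
  proof (rule image_subsetI, rule CollectI)
    fix x assume "x \<in> C12"
    then obtain a b where "a \<in> carrier P1" "b \<in> carrier P2" "x = (a, b)" by auto
    thus "cls (gen x) \<in> ?S" unfolding pure_tensor_def by (intro addclo.base) blast
  qed
  ultimately have "free_on C12 \<subseteq> {f. cls f \<in> ?S}"
    unfolding free_on_eq_span by (intro free.span_minimal)
  thus ?thesis using carrier_T_E[OF assms] by blast
qed

text \<open>The product of \<phi> and \<psi> extends linearly to the free space and kills the
  relations because it is bilinear, so it takes one value on each coset and descends.\<close>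

lemma tau_dual:
  assumes "\<phi> \<in> dual P1" "\<psi> \<in> dual P2"
  shows "\<exists>\<theta>\<in>dual T. \<forall>a\<in>carrier P1. \<forall>b\<in>carrier P2. \<theta> (tau a b) = \<phi> a * \<psi> b"
proof -
  let ?h = "\<lambda>(a, b). \<phi> a * \<psi> b"
  define \<Theta> where "\<Theta> = lin_ext (*) ?h"
  note simps = lin_ext_simps[OF vector_space_field, of ?h, folded \<Theta>_def]
  have K: "module.subspace ((*) :: 'k \<Rightarrow> 'k \<Rightarrow> 'k) {0}"
  proof -
    interpret vector_space "(*) :: 'k \<Rightarrow> 'k \<Rightarrow> 'k" by (rule vector_space_field)
    show ?thesis by (rule subspace_single_0)
  qed
  have "\<Theta> r \<in> {0}" if "r \<in> rel" for r
    using that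
    by (intro rel_induct[OF vector_space_field linear_lin_ext[OF vector_space_field, of ?h, folded \<Theta>_def] K])
      (auto simp: simps L.dual_simps[OF assms(1)] R.dual_simps[OF assms(2)] algebra_simps)
  hence \<Theta>: "\<Theta> f = \<Theta> g" if "f \<in> cls g" for f g
    using that simps(2)[of f g] by (simp add: mem_cls)
  define \<theta> where "\<theta> A = \<Theta> (SOME f. f \<in> A)" for A
  have \<theta>: "\<theta> (cls f) = \<Theta> f" for f
    unfolding \<theta>_def by (rule \<Theta>) (rule someI, rule cls_self)
  have "\<theta> \<in> dual T" by (auto simp: dual_def T_simps \<theta> simps elim!: carrier_T_E)
  moreover have "\<theta> (tau a b) = \<phi> a * \<psi> b" for a b by (simp add: pure_tensor_def \<theta> simps)
  ultimately show ?thesis by blast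
qed

text \<open>Bilinearity of \<open>k\<close> modulo the relations, which is what makes its linear
  extension preserve \<open>rel\<close>. The equations are between cosets, so that the bilinearity
  of pure tensors proves them.\<close>

definition balanced :: "('a \<times> 'b \<Rightarrow> ('a \<times> 'b \<Rightarrow>\<^sub>0 'k)) \<Rightarrow> bool" where
  "balanced k \<longleftrightarrow> (\<forall>a\<in>carrier P1. \<forall>b\<in>carrier P2. k (a, b) \<in> free_on C12 \<and>
     (\<forall>a'\<in>carrier P1. cls (k (a \<oplus>\<^bsub>P1\<^esub> a', b)) = cls (k (a, b)) \<oplus>\<^bsub>T\<^esub> cls (k (a', b))) \<and>
     (\<forall>b'\<in>carrier P2. cls (k (a, b \<oplus>\<^bsub>P2\<^esub> b')) = cls (k (a, b)) \<oplus>\<^bsub>T\<^esub> cls (k (a, b'))) \<and>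
     (\<forall>c. cls (k (c \<odot>\<^bsub>P1\<^esub> a, b)) = c \<odot>\<^bsub>T\<^esub> cls (k (a, b)) \<and>
          cls (k (a, c \<odot>\<^bsub>P2\<^esub> b)) = c \<odot>\<^bsub>T\<^esub> cls (k (a, b))))"

lemma balanced_rel:
  assumes "balanced k" "r \<in> rel"
  shows "lin_ext free_scale k r \<in> rel"
  by (rule rel_induct[OF free.vector_space_axioms linear_lin_ext[OF free.vector_space_axioms] subspace_rel _ _ _ _ assms(2)])
    (use assms(1) in \<open>simp_all add: balanced_def T_simps cls_eq_iff diff_diff_eq
      lin_ext_gen[OF free.vector_space_axioms]\<close>)

definition descends :: "('a \<times> 'b \<Rightarrow> 'a \<times> 'b \<Rightarrow> ('a \<times> 'b \<Rightarrow>\<^sub>0 'k)) \<Rightarrow> bool" where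
  "descends h \<longleftrightarrow> (\<forall>x\<in>C12. balanced (h x) \<and> balanced (\<lambda>y. h y x))"

lemma bilinear_ext_free_on:
  assumes "descends h" "f \<in> free_on C12" "g \<in> free_on C12"
  shows "bilinear_ext h f g \<in> free_on C12"
  unfolding bilinear_ext_lin_ext
proof (intro lin_ext_subspace[OF free.vector_space_axioms subspace_free_on assms(2)]
    lin_ext_subspace[OF free.vector_space_axioms subspace_free_on assms(3)])
  fix x y assume "x \<in> C12" "y \<in> C12"
  thus "h x y \<in> free_on C12" using assms(1) by (auto simp: descends_def balanced_def)
qed

lemma tlift2_bilinear_ext:
  assumes h: "descends h" and fg: "f \<in> free_on C12" "g \<in> free_on C12"
  shows "tlift2 P1 P2 (bilinear_ext h) (cls f) (cls g) = cls (bilinear_ext h f g)"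
proof (rule tlift2_cls)
  fix f' g' assume r: "f' - f \<in> rel" "g' - g \<in> rel"
  \<comment> \<open>\<open>h x\<close> is known to be balanced only for \<open>x\<close> in the
    carriers, so the new representative must be supported there too; this holds because the
    relations are.\<close>
  have f': "f' \<in> free_on C12"
    using free.subspace_add[OF subspace_free_on rel_free_on[OF r(1)] fg(1)] by simp
  have "bilinear_ext h (f' - f) g \<in> rel"
    unfolding bilinear_ext_swap
    by (rule lin_ext_subspace[OF free.vector_space_axioms subspace_rel fg(2)], rule balanced_rel)
      (use h r in \<open>auto simp: descends_def\<close>)
  moreover have "bilinear_ext h f' (g' - g) \<in> rel"
    unfolding bilinear_ext_lin_ext
    by (rule lin_ext_subspace[OF free.vector_space_axioms subspace_rel f'], rule balanced_rel)
      (use h r in \<open>auto simp: descends_def\<close>)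
  \<comment> \<open>Changing one argument at a time, the two differences telescope to the total
    one.\<close>
  ultimately have "bilinear_ext h (f' - f) g + bilinear_ext h f' (g' - g) \<in> rel"
    by (rule free.subspace_add[OF subspace_rel])
  thus "bilinear_ext h f' g' - bilinear_ext h f g \<in> rel"
    by (simp add: bilinear_ext_simps)
qed

end

section \<open>The adjoint action\<close>

lemma F_eq_geig:
  assumes "kvspace P" and D: "endo P (ad P z)"
  shows "F P z l = geig P (ad P z) l"
proof -
  interpret V: kvspace P by fact
  have S: "(\<lambda>w. ad P z w \<ominus>\<^bsub>P\<^esub> l \<odot>\<^bsub>P\<^esub> w) = shift P (ad P z) l" by (simp add: shift_def fun_eq_iff)
  \<comment> \<open>\<open>F\<close> excludes the exponent 0, which \<open>geig\<close> allows;
    raising the exponent by one closes the gap.\<close>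
  have "\<exists>n\<in>{1..}. (shift P (ad P z) l ^^ n) x = \<zero>\<^bsub>P\<^esub>" if "(shift P (ad P z) l ^^ n) x = \<zero>\<^bsub>P\<^esub>" for n x
    using V.funpow_zero_mono[OF V.endo_shift[OF D] that, of "Suc n"] by force
  thus ?thesis unfolding F_def geig_def S by auto
qed

lemma N_eq_geig:
  assumes "kvspace P" and D: "endo P (ad P z)"
  shows "N P z = geig P (ad P z) 0"
proof -
  interpret V: kvspace P by fact
  have "(shift P (ad P z) 0 ^^ n) x = (ad P z ^^ n) x" if x: "x \<in> carrier P" for n x
  proof (induction n)
    case (Suc n)
    have "(ad P z ^^ n) x \<in> carrier P" by (rule V.endo_closed[OF V.endo_funpow[OF D] x])
    thus ?case using Suc V.endo_closed[OF D] by (simp add: shift_def V.minus_eq_smult)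
  qed simp
  thus ?thesis unfolding N_def geig_def by auto
qed

text \<open>Among x, (ad z - l) x, (ad z - l)^2 x, ... the last nonzero vector is an eigenvector, so
  a nonzero generalised eigenspace already contains a proper one.\<close>

lemma Ev_iff:
  assumes "kvspace P" and D: "endo P (ad P z)"
  shows "l \<in> Ev P z \<longleftrightarrow> geig P (ad P z) l \<noteq> {\<zero>\<^bsub>P\<^esub>}"
proof -
  interpret V: kvspace P by fact
  show ?thesis
  proof
    assume "l \<in> Ev P z"
    then obtain x where x: "x \<in> carrier P" "x \<noteq> \<zero>\<^bsub>P\<^esub>" "ad P z x = l \<odot>\<^bsub>P\<^esub> x" by (auto simp: Ev_def)
    hence "shift P (ad P z) l x = \<zero>\<^bsub>P\<^esub>"
      by (simp add: shift_def a_minus_def V.M.r_neg)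
    hence "x \<in> geig P (ad P z) l"
      using x V.geig_shiftD[of x] V.lsub_zero[OF V.lsub_geig[OF D]] by simp
    thus "geig P (ad P z) l \<noteq> {\<zero>\<^bsub>P\<^esub>}" using x by auto
  next
    assume "geig P (ad P z) l \<noteq> {\<zero>\<^bsub>P\<^esub>}"
    then obtain x where "x \<in> geig P (ad P z) l" "x \<noteq> \<zero>\<^bsub>P\<^esub>"
      using V.lsub_zero[OF V.lsub_geig[OF D]] by blast
    with D show "l \<in> Ev P z"
    proof (induction rule: V.geig_induct)
      case (shift x)
      have x: "x \<in> carrier P" using shift(1) by (rule V.geig_carrier)
      show ?case
      proof (cases "shift P (ad P z) l x = \<zero>\<^bsub>P\<^esub>")
        case True
        hence "ad P z x = l \<odot>\<^bsub>P\<^esub> x"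
          using x V.minus_eq_zeroD[OF V.endo_closed[OF D x], of "l \<odot>\<^bsub>P\<^esub> x"] by (simp add: shift_def)
        thus ?thesis using x shift.prems by (auto simp: Ev_def)
      qed (use shift in blast)
    qed simp
  qed
qed

context nc_poisson_algebra
begin

lemma kvspace: "kvspace P"
  by (rule kvspace.intro) (rule scalars.module_axioms)

lemma endo_ad: "z \<in> carrier P \<Longrightarrow> endo P (ad P z)"
  by (simp add: endo_def ad_def bracket_closed bracket_add_right bracket_smult_right)

text \<open>The Leibniz rule for 1 = 1 * 1 gives {x, 1} = {x, 1} + {x, 1}.\<close>

lemma bracket_one_right: "x \<in> carrier P \<Longrightarrow> \<lbrace>x, \<one>\<rbrace> = \<zero>"
  using leibniz[of x \<one> \<one>] bracket_closed[of x \<one>] by simp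

lemma bracket_one_left: "x \<in> carrier P \<Longrightarrow> \<lbrace>\<one>, x\<rbrace> = \<zero>"
proof -
  assume x: "x \<in> carrier P"
  have "\<lbrace>\<one> \<oplus> x, \<one> \<oplus> x\<rbrace> = \<lbrace>\<one>, x\<rbrace>"
    using x by (simp add: bracket_add_left bracket_add_right bracket_self[of \<one>] bracket_self[of x]
        bracket_one_right bracket_closed)
  thus ?thesis using bracket_self[of "\<one> \<oplus> x"] x by simp
qed

text \<open>The unit is an eigenvector for 0 if it is nonzero. In the zero algebra \<open>Ev\<close>
  is empty, which is why the final equivalence is restricted to nonzero carriers.\<close>

lemma zero_in_Ev:
  assumes z: "z \<in> carrier P" and "carrier P \<noteq> {\<zero>}"
  shows "0 \<in> Ev P z"
proof -
  have "\<one> \<noteq> \<zero>" using assms(2) carrier_one_zero by simp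
  moreover have "ad P z \<one> = 0 \<odot> \<one>"
    using z kvspace.smult_0'[OF kvspace one_closed] by (simp add: ad_def bracket_one_right)
  ultimately show ?thesis unfolding Ev_def by blast
qed

end

section \<open>The tensor product of two Poisson algebras\<close>

locale poisson_pair = P: nc_poisson_algebra P1 + Q: nc_poisson_algebra P2
  for P1 :: "('k :: alg_closed_field, 'a) nc_poisson" and P2 :: "('k, 'b) nc_poisson" +
  assumes same_class: "(class_1 P1 \<and> class_1 P2) \<or> (class_2 P1 \<and> class_2 P2)"
begin

sublocale tensor_factors P1 P2
  by (rule tensor_factors.intro) (rule P.kvspace Q.kvspace)+

abbreviation "mult_gen \<equiv> \<lambda>(a1, a2) (b1, b2). gen (a1 \<otimes>\<^bsub>P1\<^esub> b1, a2 \<otimes>\<^bsub>P2\<^esub> b2)"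

abbreviation "bracket_gen \<equiv> \<lambda>(a1, a2) (b1, b2).
  gen (\<lbrace>a1, b1\<rbrace>\<^bsub>P1\<^esub>, a2 \<otimes>\<^bsub>P2\<^esub> b2) + gen (b1 \<otimes>\<^bsub>P1\<^esub> a1, \<lbrace>a2, b2\<rbrace>\<^bsub>P2\<^esub>)"

lemmas free_on_closed = free.subspace_add[OF subspace_free_on] free.subspace_diff[OF subspace_free_on]
  free.subspace_scale[OF subspace_free_on] gen_in_free_on

lemma cls_gen: "cls (gen (a, b)) = tau a b"
  by (simp add: pure_tensor_def)

lemma cls_add: "cls (f + g) = cls f \<oplus>\<^bsub>T\<^esub> cls g"
  by (simp add: T_simps)

lemmas pair_simps = P.bracket_closed Q.bracket_closed P.bracket_add_left Q.bracket_add_left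
  P.bracket_add_right Q.bracket_add_right P.bracket_smult_left Q.bracket_smult_left
  P.bracket_smult_right Q.bracket_smult_right P.smult_mult_left Q.smult_mult_left
  P.smult_mult_right Q.smult_mult_right P.l_distr Q.l_distr P.r_distr Q.r_distr
  tau_bilinear tau_in

lemma descends_mult: "descends mult_gen"
  by (auto simp: descends_def balanced_def cls_gen pair_simps intro!: free_on_closed)

lemma descends_bracket: "descends bracket_gen"
  by (auto simp: descends_def balanced_def cls_gen cls_add pair_simps W.M.a_ac W.smult_simps
      intro!: free_on_closed)

text \<open>The bracket on representatives, for both classes at once. All properties of the bracket
  on cosets are read off from it through \<open>bracket_cls\<close>.\<close>

definition bracket_ext :: "('a \<times> 'b \<Rightarrow>\<^sub>0 'k) \<Rightarrow> ('a \<times> 'b \<Rightarrow>\<^sub>0 'k) \<Rightarrow> ('a \<times> 'b \<Rightarrow>\<^sub>0 'k)" where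
  "bracket_ext f g = (if class_1 P1 \<and> class_1 P2 then bilinear_ext bracket_gen f g
     else bilinear_ext mult_gen f g - bilinear_ext mult_gen g f)"

lemma bracket_ext_free_on:
  "f \<in> free_on C12 \<Longrightarrow> g \<in> free_on C12 \<Longrightarrow> bracket_ext f g \<in> free_on C12"
  by (simp add: bracket_ext_def bilinear_ext_free_on descends_mult descends_bracket free_on_closed)

lemma bracket_ext_simps:
  "bracket_ext (f + f') g = bracket_ext f g + bracket_ext f' g"
  "bracket_ext f (g + g') = bracket_ext f g + bracket_ext f g'"
  "bracket_ext f (free_scale c g) = free_scale c (bracket_ext f g)"
  by (auto simp: bracket_ext_def bilinear_ext_simps free.scale_right_diff_distrib)

lemma bracket_cls:
  assumes f: "f \<in> free_on C12" and g: "g \<in> free_on C12"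
  shows "\<lbrace>cls f, cls g\<rbrace>\<^bsub>T\<^esub> = cls (bracket_ext f g)"
proof -
  have mult: "cls f \<otimes>\<^bsub>tensor_algebra P1 P2\<^esub> cls g = cls (bilinear_ext mult_gen f g)"
    if "f \<in> free_on C12" "g \<in> free_on C12" for f g
    using tlift2_bilinear_ext[OF descends_mult that] by (simp add: tensor_algebra_def)
  show ?thesis
    using f g
    by (simp add: poisson_tensor_fields(5) class_1_bracket_def commutator_bracket_def bracket_ext_def
        tlift2_bilinear_ext[OF descends_bracket] mult tensor_algebra_minus
        bilinear_ext_free_on[OF descends_mult])
qed

lemma bracket_T_simps:
  assumes "x \<in> carrier T" "y \<in> carrier T"
  shows bracket_T_closed: "\<lbrace>x, y\<rbrace>\<^bsub>T\<^esub> \<in> carrier T"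
    and bracket_T_add_left: "x' \<in> carrier T \<Longrightarrow> \<lbrace>x \<oplus>\<^bsub>T\<^esub> x', y\<rbrace>\<^bsub>T\<^esub> = \<lbrace>x, y\<rbrace>\<^bsub>T\<^esub> \<oplus>\<^bsub>T\<^esub> \<lbrace>x', y\<rbrace>\<^bsub>T\<^esub>"
    and bracket_T_add_right: "y' \<in> carrier T \<Longrightarrow> \<lbrace>x, y \<oplus>\<^bsub>T\<^esub> y'\<rbrace>\<^bsub>T\<^esub> = \<lbrace>x, y\<rbrace>\<^bsub>T\<^esub> \<oplus>\<^bsub>T\<^esub> \<lbrace>x, y'\<rbrace>\<^bsub>T\<^esub>"
    and bracket_T_smult_right: "\<lbrace>x, c \<odot>\<^bsub>T\<^esub> y\<rbrace>\<^bsub>T\<^esub> = c \<odot>\<^bsub>T\<^esub> \<lbrace>x, y\<rbrace>\<^bsub>T\<^esub>"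
  using assms
  by (auto elim!: carrier_T_E simp: T_simps bracket_cls bracket_ext_simps bracket_ext_free_on free_on_closed)

lemma endo_ad_T: "x \<in> carrier T \<Longrightarrow> endo T (ad T x)"
  by (simp add: endo_def ad_def bracket_T_simps)

lemma bracket_tau:
  assumes "z1 \<in> carrier P1" "z2 \<in> carrier P2" "a \<in> carrier P1" "b \<in> carrier P2"
  shows "\<lbrace>tau z1 z2, tau a b\<rbrace>\<^bsub>T\<^esub> = (if class_1 P1 \<and> class_1 P2
      then tau (\<lbrace>z1, a\<rbrace>\<^bsub>P1\<^esub>) (z2 \<otimes>\<^bsub>P2\<^esub> b) \<oplus>\<^bsub>T\<^esub> tau (a \<otimes>\<^bsub>P1\<^esub> z1) (\<lbrace>z2, b\<rbrace>\<^bsub>P2\<^esub>)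
      else tau (z1 \<otimes>\<^bsub>P1\<^esub> a) (z2 \<otimes>\<^bsub>P2\<^esub> b) \<ominus>\<^bsub>T\<^esub> tau (a \<otimes>\<^bsub>P1\<^esub> z1) (b \<otimes>\<^bsub>P2\<^esub> z2))"
proof -
  have "cls (gen x - gen y) = cls (gen x) \<ominus>\<^bsub>T\<^esub> cls (gen y)" if "x \<in> C12" "y \<in> C12" for x y
  proof -
    have "cls (gen x) \<ominus>\<^bsub>T\<^esub> cls (gen y) = cls (gen x) \<oplus>\<^bsub>T\<^esub> (- 1) \<odot>\<^bsub>T\<^esub> cls (gen y)"
      using that by (intro W.minus_eq_smult T_simps gen_in_free_on)
    thus ?thesis by (simp add: T_simps)
  qed
  moreover have "\<lbrace>tau z1 z2, tau a b\<rbrace>\<^bsub>T\<^esub> = cls (bracket_ext (gen (z1, z2)) (gen (a, b)))"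
    unfolding pure_tensor_def using assms by (intro bracket_cls gen_in_free_on) auto
  ultimately show ?thesis
    using assms by (simp add: bracket_ext_def bilinear_ext_simps cls_add cls_gen)
qed

text \<open>For Class 1 the second term of the bracket contains {1, b} = 0. For Class 2 the unit
  commutes with \<open>b\<close>, and the remaining commutator in the left factor is the bracket of
  \<open>P1\<close>.\<close>

lemma bracket_left:
  assumes "z \<in> carrier P1" "a \<in> carrier P1" "b \<in> carrier P2"
  shows "\<lbrace>tau z \<one>\<^bsub>P2\<^esub>, tau a b\<rbrace>\<^bsub>T\<^esub> = tau (\<lbrace>z, a\<rbrace>\<^bsub>P1\<^esub>) b"
proof (cases "class_1 P1 \<and> class_1 P2")
  case True
  have "tau (a \<otimes>\<^bsub>P1\<^esub> z) \<zero>\<^bsub>P2\<^esub> = \<zero>\<^bsub>T\<^esub>"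
    using tau_bilinear(4)[of "a \<otimes>\<^bsub>P1\<^esub> z" "\<zero>\<^bsub>P2\<^esub>" 0] assms by (simp add: tau_in)
  thus ?thesis using True assms by (simp add: bracket_tau Q.bracket_one_left P.bracket_closed tau_in)
next
  case False
  hence "\<lbrace>z, a\<rbrace>\<^bsub>P1\<^esub> = z \<otimes>\<^bsub>P1\<^esub> a \<ominus>\<^bsub>P1\<^esub> a \<otimes>\<^bsub>P1\<^esub> z"
    using same_class assms by (auto simp: class_2_def)
  thus ?thesis using False assms
    by (auto simp: bracket_tau L.minus_eq_smult W.minus_eq_smult tau_bilinear tau_in)
qed

lemma bracket_right:
  assumes "z \<in> carrier P2" "a \<in> carrier P1" "b \<in> carrier P2"
  shows "\<lbrace>tau \<one>\<^bsub>P1\<^esub> z, tau a b\<rbrace>\<^bsub>T\<^esub> = tau a (\<lbrace>z, b\<rbrace>\<^bsub>P2\<^esub>)"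
proof (cases "class_1 P1 \<and> class_1 P2")
  case True
  have "tau \<zero>\<^bsub>P1\<^esub> (z \<otimes>\<^bsub>P2\<^esub> b) = \<zero>\<^bsub>T\<^esub>"
    using tau_bilinear(3)[of "\<zero>\<^bsub>P1\<^esub>" "z \<otimes>\<^bsub>P2\<^esub> b" 0] assms by (simp add: tau_in)
  thus ?thesis using True assms by (simp add: bracket_tau P.bracket_one_left Q.bracket_closed tau_in)
next
  case False
  hence "\<lbrace>z, b\<rbrace>\<^bsub>P2\<^esub> = z \<otimes>\<^bsub>P2\<^esub> b \<ominus>\<^bsub>P2\<^esub> b \<otimes>\<^bsub>P2\<^esub> z"
    using same_class assms by (auto simp: class_2_def)
  thus ?thesis using False assms
    by (auto simp: bracket_tau R.minus_eq_smult W.minus_eq_smult tau_bilinear tau_in)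
qed

lemma tensor_ops_ad:
  assumes "z1 \<in> carrier P1" "z2 \<in> carrier P2"
  shows "tensor_ops P1 P2 T tau (ad P1 z1) (ad P2 z2) (ad T (tau z1 \<one>\<^bsub>P2\<^esub>)) (ad T (tau \<one>\<^bsub>P1\<^esub> z2))
    (ad T (tau z1 \<one>\<^bsub>P2\<^esub> \<oplus>\<^bsub>T\<^esub> tau \<one>\<^bsub>P1\<^esub> z2))"
proof -
  have "tensor_pair P1 P2 T tau"
    by (intro tensor_pair.intro tensor_pair_axioms.intro kvspace_closed.intro L.kvspace_axioms
        R.kvspace_axioms W.kvspace_axioms tau_in tau_bilinear tau_generates tau_dual)
  thus ?thesis
    using assms
    by (intro tensor_ops.intro tensor_ops_axioms.intro P.endo_ad Q.endo_ad endo_ad_T W.M.a_closed tau_in)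
      (auto simp: ad_def bracket_left bracket_right bracket_T_add_left tau_in)
qed

end

theorem lemma6p3:
  fixes P1 :: "('k :: {alg_closed_field, field_char_0}, 'a) nc_poisson"
    and P2 :: "('k, 'b) nc_poisson"
    and u1 :: "'a \<Rightarrow> int extended" and u2 :: "'b \<Rightarrow> int extended"
    and z1 :: 'a and z2 :: 'b
    and T :: "('k, ('a \<times> 'b \<Rightarrow>\<^sub>0 'k) set) nc_poisson" and \<Gamma> :: "('a \<times> 'b \<Rightarrow>\<^sub>0 'k) set"
  assumes "T = poisson_tensor P1 P2"
    and "\<Gamma> = pure_tensor P1 P2 z1 \<one>\<^bsub>P2\<^esub> \<oplus>\<^bsub>T\<^esub> pure_tensor P1 P2 \<one>\<^bsub>P1\<^esub> z2"
    and "nc_poisson_algebra P1" and "nc_poisson_algebra P2"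
    and "(class_1 P1 \<and> class_1 P2) \<or> (class_2 P1 \<and> class_2 P2)"
    and "degree_map P1 u1" and "degree_map P2 u2"
    and "\<forall>x\<in>carrier P1. u1 x = -\<infinity> \<or> 0 \<le> u1 x"
    and "\<forall>x\<in>carrier P2. u2 x = -\<infinity> \<or> 0 \<le> u2 x"
    and "finite_filtration P1 u1" and "discrete_filtration P1 u1"
    and "finite_filtration P2 u2" and "discrete_filtration P2 u2"
    and "z1 \<in> carrier P1" and "z2 \<in> carrier P2"
  shows "(\<forall>l. is_direct_sum T (F T \<Gamma> l) UNIV
              (\<lambda>m. tensor_subspace P1 P2 (F P1 z1 m) (F P2 z2 (l - m))))
       \<and> N T \<Gamma> = F T \<Gamma> 0
       \<and> is_direct_sum T (N T \<Gamma>) UNIV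
              (\<lambda>l. tensor_subspace P1 P2 (F P1 z1 l) (F P2 z2 (- l)))
       \<and> (carrier P1 \<noteq> {\<zero>\<^bsub>P1\<^esub>} \<and> carrier P2 \<noteq> {\<zero>\<^bsub>P2\<^esub>} \<longrightarrow>
            (N T \<Gamma> = tensor_subspace P1 P2 (N P1 z1) (N P2 z2)
             \<longleftrightarrow> Ev P1 z1 \<inter> {l. - l \<in> Ev P2 z2} = {0}))"
proof -
  note T_eq = assms(1) and \<Gamma>_eq = assms(2)
  interpret pp: poisson_pair P1 P2
    by (intro poisson_pair.intro poisson_pair_axioms.intro assms(3-5))
  interpret tensor_ops P1 P2 T "pure_tensor P1 P2" "ad P1 z1" "ad P2 z2"
    "ad T (pure_tensor P1 P2 z1 \<one>\<^bsub>P2\<^esub>)" "ad T (pure_tensor P1 P2 \<one>\<^bsub>P1\<^esub> z2)" "ad T \<Gamma>"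
    unfolding \<Gamma>_eq T_eq by (rule pp.tensor_ops_ad[OF assms(14,15)])
  let ?U = "geig P1 (ad P1 z1)" and ?V = "geig P2 (ad P2 z2)"
  have F1: "F P1 z1 l = ?U l" for l by (rule F_eq_geig[OF pp.L.kvspace_axioms D1])
  have F2: "F P2 z2 l = ?V l" for l by (rule F_eq_geig[OF pp.R.kvspace_axioms D2])
  have FT: "F T \<Gamma> l = geig T (ad T \<Gamma>) l" for l by (rule F_eq_geig[OF W.kvspace_axioms G])
  have N1: "N P1 z1 = ?U 0" by (rule N_eq_geig[OF pp.L.kvspace_axioms D1])
  have N2: "N P2 z2 = ?V 0" by (rule N_eq_geig[OF pp.R.kvspace_axioms D2])
  have NT: "N T \<Gamma> = geig T (ad T \<Gamma>) 0" by (rule N_eq_geig[OF W.kvspace_axioms G])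
  have UC: "?U l \<subseteq> carrier P1" and VC: "?V l \<subseteq> carrier P2" for l by (auto simp: geig_def)
  have TS: "tensor_subspace P1 P2 (?U l) (?V m) = ts (?U l) (?V m)" for l m
    unfolding tensor_subspace_def T_eq[symmetric] by (rule ts_eq_finsum[OF UC VC, symmetric])
  have direct: "is_direct_sum T (geig T (ad T \<Gamma>) l) UNIV (\<lambda>m. ts (?U m) (?V (l - m)))" for l
    unfolding is_direct_sum_def
  proof (intro conjI allI impI ballI)
    show "geig T (ad T \<Gamma>) l = {\<Oplus>\<^bsub>T\<^esub>i\<in>M. x i |M x. finite M \<and> M \<subseteq> UNIV \<and> (\<forall>i\<in>M. x i \<in> ts (?U i) (?V (l - i)))}"
      (is "_ = ?S")
    proof (rule subset_antisym; rule subsetI)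
      fix y assume "y \<in> geig T (ad T \<Gamma>) l"
      then obtain J x where "finite J" "\<forall>m\<in>J. x m \<in> ts (?U m) (?V (l - m))" "y = (\<Oplus>\<^bsub>T\<^esub>m\<in>J. x m)"
        by (rule geig_decompose)
      thus "y \<in> ?S" by blast
    next
      fix y assume "y \<in> ?S"
      then obtain M x where "\<forall>i\<in>M. x i \<in> ts (?U i) (?V (l - i))" "y = (\<Oplus>\<^bsub>T\<^esub>i\<in>M. x i)" by blast
      thus "y \<in> geig T (ad T \<Gamma>) l"
        by (simp only:) (rule W.lsub_finsum[OF W.lsub_geig[OF G]], rule ts_geig, blast)
    qed
  next
    fix M x i
    assume "finite M \<and> M \<subseteq> UNIV \<and> (\<forall>i\<in>M. x i \<in> ts (?U i) (?V (l - i))) \<and> (\<Oplus>\<^bsub>T\<^esub>i\<in>M. x i) = \<zero>\<^bsub>T\<^esub>"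
      and "i \<in> M"
    thus "x i = \<zero>\<^bsub>T\<^esub>" using ts_independent[of M x l i] by blast
  qed
  have "geig T (ad T \<Gamma>) 0 = ts (?U 0) (?V 0) \<longleftrightarrow> Ev P1 z1 \<inter> {l. - l \<in> Ev P2 z2} = {0}"
    if nz: "carrier P1 \<noteq> {\<zero>\<^bsub>P1\<^esub>}" "carrier P2 \<noteq> {\<zero>\<^bsub>P2\<^esub>}"
  proof
    note Ev1 = Ev_iff[OF pp.L.kvspace_axioms D1] and Ev2 = Ev_iff[OF pp.R.kvspace_axioms D2]
    assume eq: "geig T (ad T \<Gamma>) 0 = ts (?U 0) (?V 0)"
    have "l = 0" if l: "l \<in> Ev P1 z1" "- l \<in> Ev P2 z2" for l
    proof (rule ccontr)
      assume "l \<noteq> 0"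
      obtain x1 where x1: "x1 \<in> ?U l" "x1 \<noteq> \<zero>\<^bsub>P1\<^esub>"
        using l(1) Ev1 pp.L.lsub_zero[OF pp.L.lsub_geig[OF D1]] by blast
      obtain x2 where x2: "x2 \<in> ?V (- l)" "x2 \<noteq> \<zero>\<^bsub>P2\<^esub>"
        using l(2) Ev2 pp.R.lsub_zero[OF pp.R.lsub_geig[OF D2]] by blast
      have C: "x1 \<in> carrier P1" "x2 \<in> carrier P2" using x1 x2 UC VC by auto
      let ?x = "pure_tensor P1 P2 x1 x2"
      \<comment> \<open>The tensor of the two vectors lies in N(\<Gamma>), hence by
        \<open>eq\<close> in the summand of index 0. It is then a generalised eigenvector of ad (z1
        (x) 1) for both \<open>l\<close> and 0, so it vanishes.\<close>
      have "?x \<in> ts (?U l) (?V (0 - l))" using x1 x2 by (intro ts_base) auto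
      hence "?x \<in> ts (?U 0) (?V 0)" unfolding eq[symmetric] by (rule ts_geig)
      hence "?x = \<zero>\<^bsub>T\<^esub>"
        using W.geig_disjoint[OF G1 tau_geig_left[OF x1(1) C(2)] ts_geig_left[OF _ VC]] \<open>l \<noteq> 0\<close> by simp
      thus False using tau_nonzero C x1 x2 by blast
    qed
    moreover have "0 \<in> Ev P1 z1" "0 \<in> Ev P2 z2"
      using nz assms(14,15) by (auto intro: pp.P.zero_in_Ev pp.Q.zero_in_Ev)
    ultimately show "Ev P1 z1 \<inter> {l. - l \<in> Ev P2 z2} = {0}" by auto
  next
    note Ev1 = Ev_iff[OF pp.L.kvspace_axioms D1] and Ev2 = Ev_iff[OF pp.R.kvspace_axioms D2]
    assume Ev: "Ev P1 z1 \<inter> {l. - l \<in> Ev P2 z2} = {0}"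
    have S: "lsub T (ts (?U 0) (?V 0))" by (rule lsub_ts[OF pp.L.lsub_geig[OF D1] pp.R.lsub_geig[OF D2]])
    show "geig T (ad T \<Gamma>) 0 = ts (?U 0) (?V 0)"
    proof (rule subset_antisym; rule subsetI)
      fix y assume "y \<in> ts (?U 0) (?V 0)"
      thus "y \<in> geig T (ad T \<Gamma>) 0" by (intro ts_geig[of y 0]) simp
    next
      fix y assume "y \<in> geig T (ad T \<Gamma>) 0"
      then obtain J x where J: "finite J" "\<forall>m\<in>J. x m \<in> ts (?U m) (?V (0 - m))" "y = (\<Oplus>\<^bsub>T\<^esub>m\<in>J. x m)"
        by (rule geig_decompose)
      have "x m \<in> ts (?U 0) (?V 0)" if "m \<in> J" for m
      proof (cases "m = 0")
        case True
        thus ?thesis using J(2) that by auto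
      next
        case False
        \<comment> \<open>A nonzero index \<open>m\<close> is outside the intersection, so by
          \<open>Ev_iff\<close> one of the factors vanishes and with it the whole summand.\<close>
        hence "?U m = {\<zero>\<^bsub>P1\<^esub>} \<or> ?V (- m) = {\<zero>\<^bsub>P2\<^esub>}"
          using Ev Ev1 Ev2 by blast
        hence zero: "pure_tensor P1 P2 u v \<in> {\<zero>\<^bsub>T\<^esub>}" if "u \<in> ?U m" "v \<in> ?V (- m)" for u v
        proof (elim disjE)
          assume "?U m = {\<zero>\<^bsub>P1\<^esub>}"
          thus ?thesis using that tau_zero_left[OF subsetD[OF VC that(2)]] by simp
        next
          assume "?V (- m) = {\<zero>\<^bsub>P2\<^esub>}"
          thus ?thesis using that tau_zero_right[OF subsetD[OF UC that(1)]] by simp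
        qed
        have "x m \<in> ts (?U m) (?V (- m))" using J(2) that by auto
        hence "x m \<in> {\<zero>\<^bsub>T\<^esub>}" by (rule ts_subset_lsub[OF _ W.lsub_0 zero])
        thus ?thesis using W.lsub_zero[OF S] by simp
      qed
      thus "y \<in> ts (?U 0) (?V 0)" unfolding J(3) by (intro W.lsub_finsum[OF S])
    qed
  qed
  thus ?thesis
    using direct direct[of 0] by (simp add: F1 F2 FT N1 N2 NT TS)
qed

end
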